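(* Let $G=(V,E)$ be a locally finite, connected, infinite graph, fix a vertex $x\in V$, and consider Bernoulli$(p)$ bond percolation on $G$. Then \[ p'_{\mathrm{cut,E}}=p'_{\mathrm{cut,V}}=p_{\mathrm{c}}. \]
   Context: Bernoulli$(p)$ bond percolation on $G$ keeps each edge independently as "open" with probability $p$ and otherwise declares it "closed"; $\mathbb{P}_p$ denotes its law. An open path is a path all of whose edges are open; $x\longleftrightarrow\infty$ is the event that the open cluster of $x$ has infinite diameter. The critical probability is $p_{\mathrm{c}}=\sup\{p\ge 0:\mathbb{P}_p(x\longleftrightarrow\infty)=0\}$. A vertex cutset separating $x$ from infinity is a set $\Pi\subset V$ such that the connected component of $x$ in the graph obtained from $G$ by deleting the vertices of $\Pi$ is finite; an edge cutset separating $x$ from infinity is a set $\Pi_E\subset E$ such that the connected component of $x$ in $G$ with the edges of $\Pi_E$ deleted is finite. For a vertex cutset $\Pi$ and $v\in\Pi$, $A(x,v,\Pi)$ is the event that $x$ is connected to $v$ by an open path that uses no vertex of $\Pi\setminus\{v\}$. For an edge cutset $\Pi_E$ and $e\in\Pi_E$, $A(x,e,\Pi_E)$ is the event that $e$ is open and $x$ is connected to $e$ by an open path that uses no edge of $\Pi_E\setminus\{e\}$. Define $p'_{\mathrm{cut,V}}=\sup\{p\ge0:\inf_{\Pi}\sum_{v\in\Pi}\mathbb{P}_p[A(x,v,\Pi)]=0\}$, the infimum over all vertex cutsets $\Pi$ separating $x$ from infinity, and $p'_{\mathrm{cut,E}}=\sup\{p\ge0:\inf_{\Pi_E}\sum_{e\in\Pi_E}\mathbb{P}_p[A(x,e,\Pi_E)]=0\}$,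 the infimum over all edge cutsets $\Pi_E$ separating $x$ from infinity. *)

theory Defs
  imports "HOL-Probability.Probability"
begin

text \<open>A graph is given by a vertex set V and a set E of undirected edges,
each edge being a two-element subset of V. A percolation configuration is a
function from edges to bool (True = open).\<close>

definition simple_graph :: "'a set \<Rightarrow> 'a set set \<Rightarrow> bool" where
  "simple_graph V E \<longleftrightarrow> (\<forall>e\<in>E. \<exists>u v. u \<noteq> v \<and> u \<in> V \<and> v \<in> V \<and> e = {u, v})"

definition locally_finite :: "'a set \<Rightarrow> 'a set set \<Rightarrow> bool" where
  "locally_finite V E \<longleftrightarrow> (\<forall>v\<in>V. finite {e\<in>E. v \<in> e})"

definition walk :: "'a set set \<Rightarrow> 'a list \<Rightarrow> bool" where
  "walk E xs \<longleftrightarrow> xs \<noteq> [] \<and> (\<forall>i. Suc i < length xs \<longrightarrow> {xs!i, xs!Suc i} \<in> E)"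

definition walk_edges :: "'a list \<Rightarrow> 'a set set" where
  "walk_edges xs = {{xs!i, xs!Suc i} | i. Suc i < length xs}"

definition graph_connected :: "'a set \<Rightarrow> 'a set set \<Rightarrow> bool" where
  "graph_connected V E \<longleftrightarrow>
     (\<forall>u\<in>V. \<forall>v\<in>V. \<exists>xs. walk E xs \<and> hd xs = u \<and> last xs = v)"

definition open_walk :: "'a set set \<Rightarrow> ('a set \<Rightarrow> bool) \<Rightarrow> 'a list \<Rightarrow> bool" where
  "open_walk E \<omega> xs \<longleftrightarrow> walk E xs \<and> (\<forall>e\<in>walk_edges xs. \<omega> e)"

definition perc :: "'a set set \<Rightarrow> real \<Rightarrow> ('a set \<Rightarrow> bool) measure" where
  "perc E p = PiM E (\<lambda>_. measure_pmf (bernoulli_pmf p))"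

text \<open>The open cluster of x has infinite diameter (w.r.t. the graph distance):
for every n, x is joined by an open path to some y at graph distance > n.\<close>
definition connects_to_infinity :: "'a set set \<Rightarrow> 'a \<Rightarrow> ('a set \<Rightarrow> bool) \<Rightarrow> bool" where
  "connects_to_infinity E x \<omega> \<longleftrightarrow>
     (\<forall>n::nat. \<exists>y. (\<exists>xs. open_walk E \<omega> xs \<and> hd xs = x \<and> last xs = y) \<and>
        \<not> (\<exists>ys. walk E ys \<and> hd ys = x \<and> last ys = y \<and> length ys \<le> Suc n))"

definition p_c :: "'a set \<Rightarrow> 'a set set \<Rightarrow> 'a \<Rightarrow> real" where
  "p_c V E x = Sup {p. 0 \<le> p \<and> p \<le> 1 \<and>
      measure (perc E p) {\<omega> \<in> space (perc E p). connects_to_infinity E x \<omega>} = 0}"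

definition vertex_cutset :: "'a set \<Rightarrow> 'a set set \<Rightarrow> 'a \<Rightarrow> 'a set \<Rightarrow> bool" where
  "vertex_cutset V E x C \<longleftrightarrow> C \<subseteq> V \<and>
     finite {y. \<exists>xs. walk E xs \<and> hd xs = x \<and> last xs = y \<and> set xs \<inter> C = {}}"

definition edge_cutset :: "'a set \<Rightarrow> 'a set set \<Rightarrow> 'a \<Rightarrow> 'a set set \<Rightarrow> bool" where
  "edge_cutset V E x CE \<longleftrightarrow> CE \<subseteq> E \<and>
     finite {y. \<exists>xs. walk E xs \<and> hd xs = x \<and> last xs = y \<and> walk_edges xs \<inter> CE = {}}"

definition A_vertex :: "'a set set \<Rightarrow> 'a \<Rightarrow> 'a \<Rightarrow> 'a set \<Rightarrow> ('a set \<Rightarrow> bool) \<Rightarrow> bool" where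
  "A_vertex E x v C \<omega> \<longleftrightarrow>
     (\<exists>xs. open_walk E \<omega> xs \<and> hd xs = x \<and> last xs = v \<and> set xs \<inter> (C - {v}) = {})"

definition A_edge :: "'a set set \<Rightarrow> 'a \<Rightarrow> 'a set \<Rightarrow> 'a set set \<Rightarrow> ('a set \<Rightarrow> bool) \<Rightarrow> bool" where
  "A_edge E x e CE \<omega> \<longleftrightarrow> \<omega> e \<and>
     (\<exists>xs. open_walk E \<omega> xs \<and> hd xs = x \<and> last xs \<in> e \<and> walk_edges xs \<inter> (CE - {e}) = {})"

definition p_cut_V :: "'a set \<Rightarrow> 'a set set \<Rightarrow> 'a \<Rightarrow> real" where
  "p_cut_V V E x = Sup {p. 0 \<le> p \<and> p \<le> 1 \<and>
      (INF C\<in>{C. vertex_cutset V E x C}.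
         infsum (\<lambda>v. emeasure (perc E p) {\<omega> \<in> space (perc E p). A_vertex E x v C \<omega>}) C)
      = (0::ennreal)}"

definition p_cut_E :: "'a set \<Rightarrow> 'a set set \<Rightarrow> 'a \<Rightarrow> real" where
  "p_cut_E V E x = Sup {p. 0 \<le> p \<and> p \<le> 1 \<and>
      (INF CE\<in>{CE. edge_cutset V E x CE}.
         infsum (\<lambda>e. emeasure (perc E p) {\<omega> \<in> space (perc E p). A_edge E x e CE \<omega>}) CE)
      = (0::ennreal)}"

end

theory Submission
  imports Defs
begin

text \<open>
  If the cutset sums have infimum zero at \<open>p\<close>, the union bound over a cutset rules out
  percolation at \<open>p\<close>.  Conversely, let \<open>c\<close> be a positive lower bound of the cutset sums at \<open>p\<close>.
  For a ball \<open>B\<close> around \<open>x\<close>, let \<open>S(\<omega>)\<close> be the set of vertices that are not joined to the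
  complement of \<open>B\<close> by open edges.  The event \<open>S(\<omega>) = S\<close> depends only on edges not contained
  in \<open>S\<close>, hence is independent of the connections inside \<open>S\<close>, and an edge of the boundary of
  \<open>S\<close> that is reached from \<open>x\<close> inside \<open>S\<close> is pivotal.  Since the edge boundary and
  the inner vertex boundary of \<open>S\<close> are cutsets, Russo's formula turns this into the
  inequality \<open>\<psi>' \<le> - c \<psi>\<close> of Duminil-Copin and Tassion for the probability \<open>\<psi>\<close> that
  \<open>x\<close> does not reach the complement of \<open>B\<close>.  Integrating it over \<open>[p, q]\<close> gives
  \<open>\<psi>(q) \<le> exp (- c (q - p))\<close> uniformly in \<open>B\<close>.
\<close>

section \<open>Finite product measures and Russo's formula\<close>

text \<open>For finite \<open>F\<close>, the expectation of \<open>f\<close> over independent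
  Bernoulli(\<open>q\<close>) bits indexed by \<open>F\<close>, with a configuration encoded as its
  set of open elements. Being a polynomial in \<open>q\<close>, it can be differentiated at every
  real point.\<close>

definition bexp :: "'b set \<Rightarrow> real \<Rightarrow> ('b set \<Rightarrow> real) \<Rightarrow> real" where
  "bexp F q f = (\<Sum>\<omega>\<in>Pow F. q ^ card \<omega> * (1 - q) ^ card (F - \<omega>) * f \<omega>)"

lemma bexp_empty [simp]: "bexp {} q f = f {}"
  by (simp add: bexp_def)

lemma bexp_insert:
  assumes "finite F" "e \<notin> F"
  shows "bexp (insert e F) q f = q * bexp F q (\<lambda>\<omega>. f (insert e \<omega>)) + (1 - q) * bexp F q f"
proof -
  let ?w = "\<lambda>F \<omega>. q ^ card \<omega> * (1 - q) ^ card (F - \<omega>)"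
  have fin: "finite \<omega>" if "\<omega> \<in> Pow F" for \<omega>
    using that assms(1) by (auto intro: finite_subset)
  have inj: "inj_on (insert e) (Pow F)"
    using assms(2) by (intro inj_onI) (metis PowD insert_ident subsetD)
  have "bexp (insert e F) q f = (\<Sum>\<omega>\<in>Pow F. ?w (insert e F) \<omega> * f \<omega>) +
      (\<Sum>\<omega>\<in>insert e ` Pow F. ?w (insert e F) \<omega> * f \<omega>)"
    unfolding bexp_def Pow_insert using assms by (intro sum.union_disjoint) auto
  also have "(\<Sum>\<omega>\<in>insert e ` Pow F. ?w (insert e F) \<omega> * f \<omega>) =
      (\<Sum>\<omega>\<in>Pow F. ?w (insert e F) (insert e \<omega>) * f (insert e \<omega>))"
    by (simp add: sum.reindex[OF inj])
  also have "\<dots> = (\<Sum>\<omega>\<in>Pow F. q * (?w F \<omega> * f (insert e \<omega>)))"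
  proof (intro sum.cong refl)
    fix \<omega> assume w: "\<omega> \<in> Pow F"
    then have "e \<notin> \<omega>" using assms(2) by auto
    with w have "insert e F - insert e \<omega> = F - \<omega>" and "card (insert e \<omega>) = Suc (card \<omega>)"
      using assms fin[OF w] by auto
    then show "?w (insert e F) (insert e \<omega>) * f (insert e \<omega>) = q * (?w F \<omega> * f (insert e \<omega>))"
      by simp
  qed
  also have "(\<Sum>\<omega>\<in>Pow F. ?w (insert e F) \<omega> * f \<omega>) = (\<Sum>\<omega>\<in>Pow F. (1 - q) * (?w F \<omega> * f \<omega>))"
  proof (intro sum.cong refl)
    fix \<omega> assume w: "\<omega> \<in> Pow F"
    then have "insert e F - \<omega> = insert e (F - \<omega>)"
      using assms by auto
    then have "card (insert e F - \<omega>) = Suc (card (F - \<omega>))"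
      using assms by simp
    then show "?w (insert e F) \<omega> * f \<omega> = (1 - q) * (?w F \<omega> * f \<omega>)"
      by simp
  qed
  finally show ?thesis
    by (simp add: bexp_def sum_distrib_left)
qed

lemma bexp_diff: "bexp F q (\<lambda>\<omega>. f \<omega> - g \<omega>) = bexp F q f - bexp F q g"
  by (simp add: bexp_def sum_subtractf right_diff_distrib)

lemma bexp_sum: "bexp F q (\<lambda>\<omega>. \<Sum>i\<in>I. f i \<omega>) = (\<Sum>i\<in>I. bexp F q (f i))"
  unfolding bexp_def by (subst sum.swap) (simp add: sum_distrib_left)

lemma bexp_mono:
  assumes "0 \<le> q" "q \<le> 1" "\<And>\<omega>. \<omega> \<subseteq> F \<Longrightarrow> f \<omega> \<le> g \<omega>"
  shows "bexp F q f \<le> bexp F q g"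
  unfolding bexp_def using assms by (intro sum_mono mult_left_mono) auto

lemma bexp_nonneg:
  assumes "0 \<le> q" "q \<le> 1" "\<And>\<omega>. \<omega> \<subseteq> F \<Longrightarrow> 0 \<le> f \<omega>"
  shows "0 \<le> bexp F q f"
  unfolding bexp_def using assms by (intro sum_nonneg mult_nonneg_nonneg) auto

lemma bexp_one: "finite F \<Longrightarrow> bexp F q (\<lambda>\<omega>. 1) = 1"
  by (induction F rule: finite_induct) (simp_all add: bexp_insert)

text \<open>Condition on the new coordinate \<open>e\<close>. One of \<open>f\<close> and
  \<open>g\<close> ignores it; the other is replaced by its section with \<open>e\<close> open,
  which depends on the same side of \<open>K\<close> as before. This is why the induction
  generalises over \<open>f\<close> and \<open>g\<close>.\<close>

lemma bexp_indep:
  assumes "finite F" "\<And>\<omega>. f \<omega> = f (\<omega> \<inter> K)" "\<And>\<omega>. g \<omega> = g (\<omega> - K)"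
  shows "bexp F q (\<lambda>\<omega>. f \<omega> * g \<omega>) = bexp F q f * bexp F q g"
  using assms
proof (induction F arbitrary: f g rule: finite_induct)
  case empty
  then show ?case by simp
next
  case (insert e F)
  show ?case
  proof (cases "e \<in> K")
    case True
    have g: "g (insert e \<omega>) = g \<omega>" for \<omega>
    proof -
      have "g (insert e \<omega>) = g (insert e \<omega> - K)" by (rule insert.prems)
      also have "insert e \<omega> - K = \<omega> - K" using True by auto
      also have "g (\<omega> - K) = g \<omega>" by (rule insert.prems(2)[symmetric])
      finally show ?thesis .
    qed
    have f: "f (insert e \<omega>) = f (insert e (\<omega> \<inter> K))" for \<omega>
    proof -
      have "f (insert e \<omega>) = f (insert e \<omega> \<inter> K)" by (rule insert.prems)
      also have "insert e \<omega> \<inter> K = insert e (\<omega> \<inter> K) \<inter> K" by auto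
      also have "f \<dots> = f (insert e (\<omega> \<inter> K))" by (rule insert.prems(1)[symmetric])
      finally show ?thesis .
    qed
    have "bexp F q (\<lambda>\<omega>. f \<omega> * g \<omega>) = bexp F q f * bexp F q g"
      using insert.prems by (rule insert.IH)
    moreover have "bexp F q (\<lambda>\<omega>. f (insert e \<omega>) * g \<omega>) = bexp F q (\<lambda>\<omega>. f (insert e \<omega>)) * bexp F q g"
      using f insert.prems(2) by (rule insert.IH)
    ultimately show ?thesis
      by (simp add: bexp_insert insert.hyps g algebra_simps)
  next
    case False
    have f: "f (insert e \<omega>) = f \<omega>" for \<omega>
    proof -
      have "f (insert e \<omega>) = f (insert e \<omega> \<inter> K)" by (rule insert.prems)
      also have "insert e \<omega> \<inter> K = \<omega> \<inter> K" using False by auto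
      also have "f (\<omega> \<inter> K) = f \<omega>" by (rule insert.prems(1)[symmetric])
      finally show ?thesis .
    qed
    have g: "g (insert e \<omega>) = g (insert e (\<omega> - K))" for \<omega>
    proof -
      have "g (insert e \<omega>) = g (insert e \<omega> - K)" by (rule insert.prems)
      also have "insert e \<omega> - K = insert e (\<omega> - K) - K" by auto
      also have "g \<dots> = g (insert e (\<omega> - K))" by (rule insert.prems(2)[symmetric])
      finally show ?thesis .
    qed
    have "bexp F q (\<lambda>\<omega>. f \<omega> * g \<omega>) = bexp F q f * bexp F q g"
      using insert.prems by (rule insert.IH)
    moreover have "bexp F q (\<lambda>\<omega>. f \<omega> * g (insert e \<omega>)) = bexp F q f * bexp F q (\<lambda>\<omega>. g (insert e \<omega>))"
      using insert.prems(1) g by (rule insert.IH)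
    ultimately show ?thesis
      by (simp add: bexp_insert insert.hyps f algebra_simps)
  qed
qed

text \<open>Condition on one coordinate \<open>e\<close> and use the product rule: differentiating
  the weights \<open>q\<close> and \<open>1 - q\<close> gives the summand of \<open>e\<close>, and
  the induction hypothesis for the two sections of \<open>f\<close> gives the others. For the
  indicator of an increasing event each summand is the probability that \<open>e\<close> is
  pivotal.\<close>

lemma russo_formula:
  assumes "finite F"
  shows "((\<lambda>q. bexp F q f) has_real_derivative
    (\<Sum>e\<in>F. bexp F q (\<lambda>\<omega>. f (insert e \<omega>) - f (\<omega> - {e})))) (at q)"
  using assms
proof (induction F arbitrary: f rule: finite_induct)
  case empty
  then show ?case by simp
next
  case (insert e F)
  let ?D = "\<lambda>f. \<Sum>g\<in>F. bexp F q (\<lambda>\<omega>. f (insert g \<omega>) - f (\<omega> - {g}))"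
  let ?fe = "\<lambda>\<omega>. f (insert e \<omega>)"
  have "((\<lambda>q. q * bexp F q ?fe + (1 - q) * bexp F q f) has_real_derivative
      (1 * bexp F q ?fe + ?D ?fe * q) + ((0 - 1) * bexp F q f + ?D f * (1 - q))) (at q)"
    by (intro derivative_intros insert.IH)
  moreover have "(\<Sum>g\<in>insert e F. bexp (insert e F) q (\<lambda>\<omega>. f (insert g \<omega>) - f (\<omega> - {g}))) =
      (1 * bexp F q ?fe + ?D ?fe * q) + ((0 - 1) * bexp F q f + ?D f * (1 - q))"
  proof -
    have eq: "\<omega> - {e} = \<omega>" if "\<omega> \<in> Pow F" for \<omega> using that insert.hyps by auto
    have "bexp F q (\<lambda>\<omega>. f (\<omega> - {e})) = bexp F q f"
      unfolding bexp_def by (intro sum.cong refl) (simp add: eq)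
    then have 1: "bexp (insert e F) q (\<lambda>\<omega>. f (insert e \<omega>) - f (\<omega> - {e})) = bexp F q ?fe - bexp F q f"
      using insert.hyps by (simp add: bexp_insert bexp_diff algebra_simps)
    have "bexp (insert e F) q (\<lambda>\<omega>. f (insert g \<omega>) - f (\<omega> - {g})) =
        bexp F q (\<lambda>\<omega>. ?fe (insert g \<omega>) - ?fe (\<omega> - {g})) * q +
        bexp F q (\<lambda>\<omega>. f (insert g \<omega>) - f (\<omega> - {g})) * (1 - q)" if "g \<in> F" for g
    proof -
      have "g \<noteq> e" using that insert.hyps by auto
      then have "insert e \<omega> - {g} = insert e (\<omega> - {g})" for \<omega> by auto
      then show ?thesis
        using insert.hyps by (simp add: bexp_insert insert_commute)
    qed
    then have "(\<Sum>g\<in>F. bexp (insert e F) q (\<lambda>\<omega>. f (insert g \<omega>) - f (\<omega> - {g}))) =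
        ?D ?fe * q + ?D f * (1 - q)"
      by (simp only: sum_distrib_right sum.distrib[symmetric] cong: sum.cong)
    then show ?thesis
      using insert.hyps 1 by simp
  qed
  ultimately show ?case
    by (simp only: bexp_insert[OF insert.hyps])
qed

text \<open>For increasing \<open>f\<close> every summand of Russo's formula is nonnegative.\<close>

lemma bexp_mono_param:
  assumes "finite F" "0 \<le> p" "p \<le> q" "q \<le> 1" "\<And>\<omega> \<omega>'. \<omega> \<subseteq> \<omega>' \<Longrightarrow> f \<omega> \<le> f \<omega>'"
  shows "bexp F p f \<le> bexp F q f"
proof (rule DERIV_nonneg_imp_nondecreasing[OF assms(3)])
  fix r assume r: "p \<le> r" "r \<le> q"
  have "0 \<le> (\<Sum>e\<in>F. bexp F r (\<lambda>\<omega>. f (insert e \<omega>) - f (\<omega> - {e})))"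
    using r assms by (intro sum_nonneg bexp_nonneg) (auto simp: subset_insertI2)
  then show "\<exists>y. ((\<lambda>a. bexp F a f) has_real_derivative y) (at r) \<and> 0 \<le> y"
    using russo_formula[OF assms(1)] by blast
qed

section \<open>The differential inequality\<close>

text \<open>Edges become a relation, so connection by a path is its reflexive transitive closure and
  path arguments become closure inductions.\<close>

definition adj :: "'a set set \<Rightarrow> ('a \<times> 'a) set" where
  "adj H = {(u, v). {u, v} \<in> H}"

definition edge_boundary :: "'a set set \<Rightarrow> 'a set \<Rightarrow> 'a set set" where
  "edge_boundary H S = {e \<in> H. e \<inter> S \<noteq> {} \<and> \<not> e \<subseteq> S}"

lemma adj_mono: "H \<subseteq> H' \<Longrightarrow> adj H \<subseteq> adj H'"
  by (auto simp: adj_def)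

lemma adj_rtrancl_mono: "(u, v) \<in> (adj H)\<^sup>* \<Longrightarrow> H \<subseteq> H' \<Longrightarrow> (u, v) \<in> (adj H')\<^sup>*"
  by (rule subsetD[OF rtrancl_mono[OF adj_mono]])

lemma adj_step: "(u, v) \<in> (adj H)\<^sup>* \<Longrightarrow> {v, w} \<in> H \<Longrightarrow> (u, w) \<in> (adj H)\<^sup>*"
  by (rule rtrancl_into_rtrancl) (auto simp: adj_def)

lemma adj_step_converse: "{u, v} \<in> H \<Longrightarrow> (v, w) \<in> (adj H)\<^sup>* \<Longrightarrow> (u, w) \<in> (adj H)\<^sup>*"
  by (rule converse_rtrancl_into_rtrancl) (auto simp: adj_def)

section \<open>The set of vertices not joined to the complement of \<open>B\<close>\<close>

definition confined :: "'a set \<Rightarrow> 'a set set \<Rightarrow> 'a set" where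
  "confined B \<omega> = {u. \<forall>y. (u, y) \<in> (adj \<omega>)\<^sup>* \<longrightarrow> y \<in> B}"

lemma confined_subset: "confined B \<omega> \<subseteq> B"
  by (auto simp: confined_def)

lemma confined_mono: "\<omega> \<subseteq> \<omega>' \<Longrightarrow> confined B \<omega>' \<subseteq> confined B \<omega>"
  using adj_rtrancl_mono[where H = \<omega> and H' = \<omega>'] unfolding confined_def by blast

text \<open>Exploration from outside: every vertex of an open path leaving \<open>B\<close> is
  unconfined, so none of its edges lies inside the confined set. Changing edges inside that set
  therefore neither destroys nor creates an exit.\<close>

lemma confined_cong:
  assumes "\<omega> - Pow (confined B \<omega>) = \<omega>' - Pow (confined B \<omega>)"
  shows "confined B \<omega> = confined B \<omega>'"
proof -
  let ?reach = "\<lambda>\<omega> v. \<exists>y. y \<notin> B \<and> (v, y) \<in> (adj \<omega>)\<^sup>*"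
  have conf: "v \<notin> confined B \<eta> \<longleftrightarrow> ?reach \<eta> v" for \<eta> v
    by (auto simp: confined_def)
  have reach_step: "?reach \<eta> v" if "(v, z) \<in> adj \<eta>" "?reach \<eta> z" for \<eta> v z
    using that converse_rtrancl_into_rtrancl[OF that(1)] by metis
  have out: "?reach \<omega>' v" if "(v, y) \<in> (adj \<omega>)\<^sup>*" "y \<notin> B" for v y
    using that
  proof (induction rule: converse_rtrancl_induct)
    case base
    then show ?case by blast
  next
    case (step v z)
    have "v \<notin> confined B \<omega>"
      using converse_rtrancl_into_rtrancl[OF step.hyps(1,2)] step.prems conf by metis
    then have "(v, z) \<in> adj \<omega>'"
      using step.hyps(1) assms by (auto simp: adj_def)
    then show ?case
      using step.IH[OF step.prems] by (rule reach_step)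
  qed
  have in': "?reach \<omega> v" if "(v, y) \<in> (adj \<omega>')\<^sup>*" "y \<notin> B" for v y
    using that
  proof (induction rule: converse_rtrancl_induct)
    case base
    then show ?case by blast
  next
    case (step v z)
    \<comment> \<open>The edge is only known to belong to \<open>\<omega>'\<close>. Its far endpoint
      already has an exit in \<open>\<omega>\<close>, and one unconfined endpoint is enough to put
      the edge where the two configurations agree.\<close>
    have "z \<notin> confined B \<omega>"
      using step.IH[OF step.prems] conf by metis
    then have "(v, z) \<in> adj \<omega>"
      using step.hyps(1) assms by (auto simp: adj_def)
    then show ?case
      using step.IH[OF step.prems] by (rule reach_step)
  qed
  show ?thesis
    using out in' by (auto simp: set_eq_iff confined_def) metis+
qed

text \<open>This is the locality hypothesis of \<open>bexp_indep\<close>: whether the confined set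
  equals \<open>S\<close> is decided by the edges not contained in \<open>S\<close>.\<close>

lemma confined_eq_iff: "confined B \<omega> = S \<longleftrightarrow> confined B (\<omega> - Pow S) = S"
proof
  assume "confined B \<omega> = S"
  then show "confined B (\<omega> - Pow S) = S"
    using confined_cong[of \<omega> B "\<omega> - Pow S"] by auto
next
  assume "confined B (\<omega> - Pow S) = S"
  then show "confined B \<omega> = S"
    using confined_cong[of "\<omega> - Pow S" B \<omega>] by auto
qed

lemma adj_rtrancl_within:
  "(x, u) \<in> (adj H)\<^sup>* \<Longrightarrow> H \<subseteq> Pow S \<Longrightarrow> x \<in> S \<Longrightarrow> u \<in> S"
  by (induction rule: rtrancl_induct) (auto simp: adj_def)

text \<open>The endpoint of \<open>e\<close> reached from \<open>x\<close> lies in the confined set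
  and the other one does not, so the latter already has an open path out of \<open>B\<close>.
  Opening \<open>e\<close> joins the two pieces.\<close>

lemma not_confined_insert:
  assumes "x \<in> confined B \<omega>" "e = {a, b}" "e \<in> edge_boundary F (confined B \<omega>)"
    "u \<in> e" "(x, u) \<in> (adj (\<omega> \<inter> Pow (confined B \<omega>)))\<^sup>*"
  shows "x \<notin> confined B (insert e \<omega>)"
proof -
  let ?S = "confined B \<omega>"
  have "u \<in> ?S" using adj_rtrancl_within[OF assms(5) _ assms(1)] by auto
  then obtain v where e: "e = {u, v}" and "v \<notin> ?S"
    using assms(2-4) by (auto simp: edge_boundary_def insert_commute)
  then obtain y where y: "(v, y) \<in> (adj \<omega>)\<^sup>*" "y \<notin> B" by (auto simp: confined_def)
  have "(x, v) \<in> (adj (insert e \<omega>))\<^sup>*"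
    using adj_step[OF adj_rtrancl_mono[OF assms(5)], of "insert e \<omega>" v] e by auto
  moreover have "(v, y) \<in> (adj (insert e \<omega>))\<^sup>*"
    using adj_rtrancl_mono[OF y(1)] by auto
  ultimately have "(x, y) \<in> (adj (insert e \<omega>))\<^sup>*"
    by (rule rtrancl_trans)
  then show ?thesis using y(2) by (auto simp: confined_def)
qed

lemma confined_derivative_bound:
  fixes B :: "'a set"
  assumes "finite F" "finite B" "\<And>e. e \<in> F \<Longrightarrow> \<exists>u v. e = {u, v}"
    and q: "0 \<le> q" "q \<le> 1"
    and c: "\<And>S. x \<in> S \<Longrightarrow> S \<subseteq> B \<Longrightarrow> c \<le> (\<Sum>e\<in>edge_boundary F S.
        bexp F q (\<lambda>\<omega>. of_bool (\<exists>u\<in>e. (x, u) \<in> (adj (\<omega> \<inter> Pow S))\<^sup>*)))"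
  defines "f \<equiv> \<lambda>\<omega>. of_bool (x \<in> confined B \<omega>)"
  shows "(\<Sum>e\<in>F. bexp F q (\<lambda>\<omega>. f (insert e \<omega>) - f (\<omega> - {e}))) \<le> - c * bexp F q f"
proof -
  let ?\<S> = "{S. x \<in> S \<and> S \<subseteq> B}"
  let ?h = "\<lambda>S \<omega>. of_bool (confined B \<omega> = S) :: real"
  let ?k = "\<lambda>S e \<omega>. of_bool (\<exists>u\<in>e. (x, u) \<in> (adj (\<omega> \<inter> Pow S))\<^sup>*) :: real"
  let ?b = "\<lambda>S e. of_bool (e \<in> edge_boundary F S) :: real"
  have fin: "finite ?\<S>" using assms(2) by auto
  \<comment> \<open>Partition of the event that \<open>x\<close> is confined by the value of the
    confined set: at most one \<open>S\<close> contributes, and it is admissible exactly when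
    \<open>x\<close> is confined.\<close>
  have split: "(\<Sum>S\<in>?\<S>. ?h S \<omega> * g S) = f \<omega> * g (confined B \<omega>)" for \<omega> and g :: "'a set \<Rightarrow> real"
  proof -
    have "(\<Sum>S\<in>?\<S>. ?h S \<omega> * g S) = (\<Sum>S\<in>?\<S>. if S = confined B \<omega> then g S else 0)"
      by (intro sum.cong) auto
    also have "\<dots> = f \<omega> * g (confined B \<omega>)"
      using fin by (simp add: sum.delta f_def confined_subset)
    finally show ?thesis .
  qed
  have "c * bexp F q f = c * bexp F q (\<lambda>\<omega>. \<Sum>S\<in>?\<S>. ?h S \<omega>)"
    using split[of _ "\<lambda>_. 1"] by simp
  also have "\<dots> = (\<Sum>S\<in>?\<S>. bexp F q (?h S) * c)"
    by (simp add: bexp_sum sum_distrib_left mult.commute)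
  also have "\<dots> \<le> (\<Sum>S\<in>?\<S>. bexp F q (?h S) * (\<Sum>e\<in>edge_boundary F S. bexp F q (?k S e)))"
    using q c by (intro sum_mono mult_left_mono bexp_nonneg) auto
  also have "\<dots> = (\<Sum>S\<in>?\<S>. \<Sum>e\<in>edge_boundary F S. bexp F q (\<lambda>\<omega>. ?h S \<omega> * ?k S e \<omega>))"
  proof (rule sum.cong[OF refl])
    fix S
    \<comment> \<open>The connection from \<open>x\<close> to \<open>e\<close> within
      \<open>S\<close> looks only at edges inside \<open>S\<close>, the event that the confined set
      is \<open>S\<close> only at the remaining ones.\<close>
    have "bexp F q (\<lambda>\<omega>. ?k S e \<omega> * ?h S \<omega>) = bexp F q (?k S e) * bexp F q (?h S)" for e
    proof (rule bexp_indep[OF assms(1), where K = "Pow S"])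
      show "?k S e \<omega> = ?k S e (\<omega> \<inter> Pow S)" for \<omega> by (simp add: Int_assoc)
      show "?h S \<omega> = ?h S (\<omega> - Pow S)" for \<omega> by (subst confined_eq_iff) simp
    qed
    then show "bexp F q (?h S) * (\<Sum>e\<in>edge_boundary F S. bexp F q (?k S e)) =
        (\<Sum>e\<in>edge_boundary F S. bexp F q (\<lambda>\<omega>. ?h S \<omega> * ?k S e \<omega>))"
      by (simp add: sum_distrib_left mult.commute[of "bexp F q (?h S)"] mult.commute[of "?h S _"])
  qed
  \<comment> \<open>Boundary membership is moved into an indicator so that the range of
    \<open>e\<close> no longer depends on \<open>S\<close> and the two sums can be
    exchanged.\<close>
  also have "\<dots> = (\<Sum>S\<in>?\<S>. \<Sum>e\<in>F. bexp F q (\<lambda>\<omega>. ?h S \<omega> * (?b S e * ?k S e \<omega>)))"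
  proof (rule sum.cong[OF refl])
    fix S
    have "(\<Sum>e\<in>F. bexp F q (\<lambda>\<omega>. ?h S \<omega> * (?b S e * ?k S e \<omega>))) =
        (\<Sum>e\<in>F. if e \<in> edge_boundary F S then bexp F q (\<lambda>\<omega>. ?h S \<omega> * ?k S e \<omega>) else 0)"
      by (intro sum.cong refl) (auto simp: bexp_def)
    also have "\<dots> = (\<Sum>e\<in>F \<inter> edge_boundary F S. bexp F q (\<lambda>\<omega>. ?h S \<omega> * ?k S e \<omega>))"
      using assms(1) by (simp add: sum.inter_restrict)
    also have "F \<inter> edge_boundary F S = edge_boundary F S"
      by (auto simp: edge_boundary_def)
    finally show "(\<Sum>e\<in>edge_boundary F S. bexp F q (\<lambda>\<omega>. ?h S \<omega> * ?k S e \<omega>)) =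
        (\<Sum>e\<in>F. bexp F q (\<lambda>\<omega>. ?h S \<omega> * (?b S e * ?k S e \<omega>)))" by simp
  qed
  also have "\<dots> = (\<Sum>e\<in>F. bexp F q (\<lambda>\<omega>. \<Sum>S\<in>?\<S>. ?h S \<omega> * (?b S e * ?k S e \<omega>)))"
    by (subst sum.swap) (simp add: bexp_sum)
  also have "\<dots> \<le> (\<Sum>e\<in>F. bexp F q (\<lambda>\<omega>. f (\<omega> - {e}) - f (insert e \<omega>)))"
  proof (intro sum_mono bexp_mono q)
    fix e \<omega> assume "e \<in> F"
    then obtain a b where e: "e = {a, b}" using assms(3) by blast
    let ?T = "confined B \<omega>"
    have mono: "confined B (insert e \<omega>) \<subseteq> confined B (\<omega> - {e})" "?T \<subseteq> confined B (\<omega> - {e})"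
      by (auto intro!: confined_mono)
    \<comment> \<open>If the left side is 1, then \<open>e\<close> is pivotal: \<open>x\<close> is
      confined without \<open>e\<close> and not with it, so the right side is 1 as well. Otherwise
      the left side is 0, and the right side is nonnegative because opening edges shrinks the
      confined set.\<close>
    have "f \<omega> * (?b ?T e * ?k ?T e \<omega>) \<le> f (\<omega> - {e}) - f (insert e \<omega>)"
    proof (cases "x \<in> ?T \<and> e \<in> edge_boundary F ?T \<and> (\<exists>u\<in>e. (x, u) \<in> (adj (\<omega> \<inter> Pow ?T))\<^sup>*)")
      case True
      then have "x \<notin> confined B (insert e \<omega>)"
        using not_confined_insert[OF _ e] by blast
      then show ?thesis using True mono by (auto simp: f_def)
    next
      case False
      then have "f \<omega> * (?b ?T e * ?k ?T e \<omega>) = 0"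
        unfolding f_def by (simp only: of_bool_conj[symmetric] of_bool_eq_0_iff simp_thms)
      then show ?thesis using mono by (auto simp: f_def)
    qed
    then show "(\<Sum>S\<in>?\<S>. ?h S \<omega> * (?b S e * ?k S e \<omega>)) \<le> f (\<omega> - {e}) - f (insert e \<omega>)"
      by (subst split[of \<omega> "\<lambda>S. ?b S e * ?k S e \<omega>"])
  qed
  also have "\<dots> = - (\<Sum>e\<in>F. bexp F q (\<lambda>\<omega>. f (insert e \<omega>) - f (\<omega> - {e})))"
    by (simp add: bexp_diff sum_subtractf)
  finally show ?thesis by simp
qed

lemma confined_exp_bound:
  fixes B :: "'a set"
  assumes "finite F" "finite B" "\<And>e. e \<in> F \<Longrightarrow> \<exists>u v. e = {u, v}"
    and p: "0 \<le> p" "p \<le> q" "q \<le> 1"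
    and c: "\<And>S. x \<in> S \<Longrightarrow> S \<subseteq> B \<Longrightarrow> c \<le> (\<Sum>e\<in>edge_boundary F S.
        bexp F p (\<lambda>\<omega>. of_bool (\<exists>u\<in>e. (x, u) \<in> (adj (\<omega> \<inter> Pow S))\<^sup>*)))"
  shows "bexp F q (\<lambda>\<omega>. of_bool (x \<in> confined B \<omega>)) \<le> exp (- c * (q - p))"
proof -
  let ?f = "\<lambda>\<omega>. of_bool (x \<in> confined B \<omega>) :: real"
  let ?D = "\<lambda>r. \<Sum>e\<in>F. bexp F r (\<lambda>\<omega>. ?f (insert e \<omega>) - ?f (\<omega> - {e}))"
  have D: "?D r \<le> - c * bexp F r ?f" if r: "p \<le> r" "r \<le> q" for r
  proof (rule confined_derivative_bound[OF assms(1-3)])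
    fix S assume S: "x \<in> S" "S \<subseteq> B"
    \<comment> \<open>The lower bound \<open>c\<close> is given at \<open>p\<close> only.
      Connections within \<open>S\<close> are increasing events, so it persists for every
      \<open>r\<close> in \<open>[p, q]\<close>.\<close>
    have "bexp F p (\<lambda>\<omega>. of_bool (\<exists>u\<in>e. (x, u) \<in> (adj (\<omega> \<inter> Pow S))\<^sup>*)) \<le>
        bexp F r (\<lambda>\<omega>. of_bool (\<exists>u\<in>e. (x, u) \<in> (adj (\<omega> \<inter> Pow S))\<^sup>*))" for e
    proof (rule bexp_mono_param[OF assms(1)])
      fix \<omega> \<omega>' :: "'a set set" assume "\<omega> \<subseteq> \<omega>'"
      then have "(x, u) \<in> (adj (\<omega>' \<inter> Pow S))\<^sup>*" if "(x, u) \<in> (adj (\<omega> \<inter> Pow S))\<^sup>*" for u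
        using adj_rtrancl_mono[OF that] by blast
      then show "of_bool (\<exists>u\<in>e. (x, u) \<in> (adj (\<omega> \<inter> Pow S))\<^sup>*) \<le>
          (of_bool (\<exists>u\<in>e. (x, u) \<in> (adj (\<omega>' \<inter> Pow S))\<^sup>*) :: real)"
        unfolding of_bool_def by auto
    qed (use p r in auto)
    then show "c \<le> (\<Sum>e\<in>edge_boundary F S.
        bexp F r (\<lambda>\<omega>. of_bool (\<exists>u\<in>e. (x, u) \<in> (adj (\<omega> \<inter> Pow S))\<^sup>*)))"
      by (intro order_trans[OF c[OF S]] sum_mono)
  qed (use p r in auto)
  \<comment> \<open>Integrating factor: the inequality \<open>D\<close> makes \<open>?g\<close>
    nonincreasing on \<open>[p, q]\<close>, and \<open>?g p\<close> is a probability.\<close>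
  let ?g = "\<lambda>r. bexp F r ?f * exp (c * (r - p))"
  have "?g q \<le> ?g p"
  proof (rule DERIV_nonpos_imp_nonincreasing[OF p(2)])
    fix r assume r: "p \<le> r" "r \<le> q"
    have "(?g has_real_derivative (?D r + c * bexp F r ?f) * exp (c * (r - p))) (at r)"
      by (rule derivative_eq_intros russo_formula[OF assms(1)] refl)+
        (simp add: distrib_right)
    moreover have "(?D r + c * bexp F r ?f) * exp (c * (r - p)) \<le> 0"
      using D[OF r] by (intro mult_nonpos_nonneg) auto
    ultimately show "\<exists>y. (?g has_real_derivative y) (at r) \<and> y \<le> 0"
      by blast
  qed
  also have "?g p \<le> 1"
    using bexp_mono[of p F ?f "\<lambda>_. 1"] p bexp_one[OF assms(1), of p] by simp
  finally have "bexp F q ?f * exp (c * (q - p)) \<le> 1" .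
  then have "bexp F q ?f \<le> inverse (exp (c * (q - p)))"
    by (simp add: field_simps)
  then show ?thesis
    by (simp add: exp_minus[symmetric])
qed

section \<open>Walks and cutsets\<close>

lemma walk_edges_singleton [simp]: "walk_edges [u] = {}"
  by (simp add: walk_edges_def)

lemma walk_edges_Cons_Cons [simp]:
  "walk_edges (u # v # xs) = insert {u, v} (walk_edges (v # xs))"
proof -
  have ex: "(\<exists>i. P i) \<longleftrightarrow> P 0 \<or> (\<exists>i. P (Suc i))" for P
    by (metis nat.exhaust)
  have "e \<in> walk_edges (u # v # xs) \<longleftrightarrow> e \<in> insert {u, v} (walk_edges (v # xs))" for e
    unfolding walk_edges_def mem_Collect_eq insert_iff by (subst ex) simp
  then show ?thesis by blast
qed

lemma walk_iff: "walk H xs \<longleftrightarrow> xs \<noteq> [] \<and> walk_edges xs \<subseteq> H"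
  by (auto simp: walk_def walk_edges_def)

lemma open_walk_iff: "open_walk E \<omega> xs \<longleftrightarrow> walk {e\<in>E. \<omega> e} xs"
  by (auto simp: open_walk_def walk_iff)

text \<open>A one-vertex walk has no edges, so avoidance cannot be read off the edges alone and the
  starting vertex is tested separately.\<close>

lemma walk_avoiding_iff:
  "walk H xs \<and> set xs \<inter> D = {} \<longleftrightarrow> walk {e\<in>H. e \<inter> D = {}} xs \<and> hd xs \<notin> D"
  by (induction xs rule: induct_list012) (auto simp: walk_iff)

text \<open>A list of \<open>Suc n\<close> vertices makes \<open>n\<close> steps. The same shift
  matches \<open>length ys \<le> Suc n\<close> in \<open>connects_to_infinity\<close> with distance
  at most \<open>n\<close>.\<close>

lemma walk_relpow:
  "(\<exists>xs. walk H xs \<and> hd xs = u \<and> last xs = v \<and> length xs = Suc n) \<longleftrightarrow> (u, v) \<in> adj H ^^ n"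
proof (induction n arbitrary: u)
  case 0
  have "walk H [v]" by (simp add: walk_iff)
  then show ?case by (auto simp: length_Suc_conv intro!: exI[of _ "[v]"])
next
  case (Suc n)
  show ?case
  proof
    assume "\<exists>xs. walk H xs \<and> hd xs = u \<and> last xs = v \<and> length xs = Suc (Suc n)"
    then obtain w ys where "walk H (u # w # ys)" "last (w # ys) = v" "length ys = n"
      by (auto simp: length_Suc_conv)
    then have "(u, w) \<in> adj H" "walk H (w # ys)" "last (w # ys) = v" "length (w # ys) = Suc n"
      by (auto simp: walk_iff adj_def)
    then show "(u, v) \<in> adj H ^^ Suc n"
      using Suc.IH[of w] by (intro relpow_Suc_I2) (auto intro!: exI[of _ "w # ys"])
  next
    assume "(u, v) \<in> adj H ^^ Suc n"
    then obtain w where "(u, w) \<in> adj H" "(w, v) \<in> adj H ^^ n"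
      by (meson relpow_Suc_D2)
    then obtain xs where "walk H xs" "hd xs = w" "last xs = v" "length xs = Suc n"
      using Suc.IH by blast
    moreover obtain ys where "xs = w # ys"
      using calculation by (cases xs) (auto simp: walk_iff)
    ultimately show "\<exists>xs. walk H xs \<and> hd xs = u \<and> last xs = v \<and> length xs = Suc (Suc n)"
      using \<open>(u, w) \<in> adj H\<close> by (intro exI[of _ "u # xs"]) (auto simp: walk_iff adj_def)
  qed
qed

lemma walk_rtrancl:
  "(\<exists>xs. walk H xs \<and> hd xs = u \<and> last xs = v) \<longleftrightarrow> (u, v) \<in> (adj H)\<^sup>*"
proof -
  have "\<exists>n. length xs = Suc n" if "walk H xs" for xs
    using that by (cases xs) (auto simp: walk_iff)
  then show ?thesis
    unfolding rtrancl_power walk_relpow[symmetric] by blast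
qed

lemma edge_cutset_iff:
  "edge_cutset V E x CE \<longleftrightarrow> CE \<subseteq> E \<and> finite {y. (x, y) \<in> (adj (E - CE))\<^sup>*}"
proof -
  have "walk E xs \<and> hd xs = x \<and> last xs = y \<and> walk_edges xs \<inter> CE = {} \<longleftrightarrow>
      walk (E - CE) xs \<and> hd xs = x \<and> last xs = y" for xs y
    by (auto simp: walk_iff)
  then show ?thesis
    unfolding edge_cutset_def by (simp add: walk_rtrancl)
qed

text \<open>The conjunct \<open>x \<notin> C\<close> stands inside the set because no walk from a
  vertex of \<open>C\<close> avoids \<open>C\<close>: when \<open>x \<in> C\<close> the set is
  empty, and \<open>C\<close> separates.\<close>

lemma vertex_cutset_iff:
  "vertex_cutset V E x C \<longleftrightarrow>
    C \<subseteq> V \<and> finite {y. x \<notin> C \<and> (x, y) \<in> (adj {e\<in>E. e \<inter> C = {}})\<^sup>*}"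
proof -
  have "walk E xs \<and> hd xs = x \<and> last xs = y \<and> set xs \<inter> C = {} \<longleftrightarrow>
      x \<notin> C \<and> walk {e\<in>E. e \<inter> C = {}} xs \<and> hd xs = x \<and> last xs = y" for xs y
    using walk_avoiding_iff[of E xs C] by auto
  then show ?thesis
    unfolding vertex_cutset_def by (simp add: walk_rtrancl)
qed

lemma A_edge_iff:
  "A_edge E x e CE \<omega> \<longleftrightarrow>
    \<omega> e \<and> (\<exists>u\<in>e. (x, u) \<in> (adj {g\<in>E. \<omega> g \<and> g \<notin> CE - {e}})\<^sup>*)"
proof -
  have "open_walk E \<omega> xs \<and> hd xs = x \<and> last xs \<in> e \<and> walk_edges xs \<inter> (CE - {e}) = {} \<longleftrightarrow>
      (\<exists>u\<in>e. walk {g\<in>E. \<omega> g \<and> g \<notin> CE - {e}} xs \<and> hd xs = x \<and> last xs = u)" for xs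
    by (auto simp: open_walk_iff walk_iff)
  then show ?thesis
    unfolding A_edge_def walk_rtrancl[symmetric] by auto
qed

lemma A_vertex_iff:
  "A_vertex E x v C \<omega> \<longleftrightarrow>
    x \<notin> C - {v} \<and> (x, v) \<in> (adj {g\<in>E. \<omega> g \<and> g \<inter> (C - {v}) = {}})\<^sup>*"
proof -
  have "open_walk E \<omega> xs \<and> hd xs = x \<and> last xs = v \<and> set xs \<inter> (C - {v}) = {} \<longleftrightarrow>
      x \<notin> C - {v} \<and> walk {g\<in>E. \<omega> g \<and> g \<inter> (C - {v}) = {}} xs \<and> hd xs = x \<and> last xs = v" for xs
    using walk_avoiding_iff[of "{e\<in>E. \<omega> e}" xs "C - {v}"]
    by (auto simp: open_walk_iff conj_assoc)
  then show ?thesis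
    unfolding A_vertex_def walk_rtrancl[symmetric] by simp
qed

section \<open>Balls in the graph distance\<close>

definition gball :: "'a set set \<Rightarrow> 'a \<Rightarrow> nat \<Rightarrow> 'a set" where
  "gball E x n = {y. \<exists>k\<le>n. (x, y) \<in> adj E ^^ k}"

lemma connects_to_infinity_iff:
  "connects_to_infinity E x \<omega> \<longleftrightarrow>
    (\<forall>n. \<exists>y. y \<notin> gball E x n \<and> (x, y) \<in> (adj {g\<in>E. \<omega> g})\<^sup>*)"
proof -
  have "(\<exists>ys. walk E ys \<and> hd ys = x \<and> last ys = y \<and> length ys \<le> Suc n) \<longleftrightarrow> y \<in> gball E x n" for y n
  proof -
    have "(\<exists>ys. walk E ys \<and> hd ys = x \<and> last ys = y \<and> length ys \<le> Suc n) \<longleftrightarrow>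
        (\<exists>k\<le>n. \<exists>ys. walk E ys \<and> hd ys = x \<and> last ys = y \<and> length ys = Suc k)"
    proof safe
      fix ys assume "walk E ys" "length ys \<le> Suc n"
      moreover obtain k where "length ys = Suc k"
        using \<open>walk E ys\<close> by (cases ys) (auto simp: walk_iff)
      ultimately show "\<exists>k\<le>n. \<exists>zs. walk E zs \<and> hd zs = hd ys \<and> last zs = last ys \<and> length zs = Suc k"
        by auto
    qed auto
    then show ?thesis by (simp add: gball_def walk_relpow)
  qed
  then show ?thesis
    unfolding connects_to_infinity_def open_walk_iff walk_rtrancl by auto
qed

lemma gball_0 [simp]: "gball E x 0 = {x}"
  by (auto simp: gball_def)

lemma gball_mono: "m \<le> n \<Longrightarrow> gball E x m \<subseteq> gball E x n"
  unfolding gball_def using order_trans by fast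

lemma gball_Suc_subset: "gball E x (Suc n) \<subseteq> gball E x n \<union> \<Union> {e\<in>E. e \<inter> gball E x n \<noteq> {}}"
proof
  fix y assume "y \<in> gball E x (Suc n)"
  then obtain k where k: "k \<le> Suc n" "(x, y) \<in> adj E ^^ k" by (auto simp: gball_def)
  show "y \<in> gball E x n \<union> \<Union> {e\<in>E. e \<inter> gball E x n \<noteq> {}}"
  proof (cases "k \<le> n")
    case True
    then show ?thesis using k by (auto simp: gball_def)
  next
    case False
    then have "(x, y) \<in> adj E ^^ Suc n" using k by (metis le_SucE)
    then obtain z where "(x, z) \<in> adj E ^^ n" "{z, y} \<in> E" by (auto simp: adj_def)
    moreover have "z \<in> gball E x n" using calculation by (auto simp: gball_def)
    ultimately show ?thesis by blast
  qed
qed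

lemma rtrancl_in_gball: "(x, y) \<in> (adj E)\<^sup>* \<Longrightarrow> \<exists>n. y \<in> gball E x n"
  unfolding gball_def rtrancl_power by blast

text \<open>With this, a cluster that leaves every ball also leaves every finite set of vertices
  reachable from \<open>x\<close>, in particular the finite component left by a cutset.\<close>

lemma finite_subset_gball:
  assumes "finite K" "\<And>y. y \<in> K \<Longrightarrow> (x, y) \<in> (adj E)\<^sup>*"
  shows "\<exists>n. K \<subseteq> gball E x n"
  using assms
proof (induction K rule: finite_induct)
  case empty
  then show ?case by simp
next
  case (insert y K)
  then obtain m n where "K \<subseteq> gball E x m" "y \<in> gball E x n"
    using rtrancl_in_gball by (metis insertCI)
  then show ?case
    using gball_mono[of m "max m n" E x] gball_mono[of n "max m n" E x]
    by (intro exI[of _ "max m n"]) auto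
qed

section \<open>Boundaries of finite sets as cutsets, and paths that meet a cutset\<close>

definition vertex_boundary :: "'a set set \<Rightarrow> 'a set \<Rightarrow> 'a set" where
  "vertex_boundary H S = {v\<in>S. \<exists>e\<in>edge_boundary H S. v \<in> e}"

lemma edge_cutset_edge_boundary:
  assumes "finite S" "x \<in> S"
  shows "edge_cutset V E x (edge_boundary E S)"
proof -
  have "y \<in> S" if "(x, y) \<in> (adj (E - edge_boundary E S))\<^sup>*" for y
    using that
  proof (induction rule: rtrancl_induct)
    case base
    then show ?case using assms by simp
  next
    case (step z y)
    then show ?case by (auto simp: adj_def edge_boundary_def)
  qed
  then have "{y. (x, y) \<in> (adj (E - edge_boundary E S))\<^sup>*} \<subseteq> S" by blast
  then show ?thesis
    using assms(1) by (auto simp: edge_cutset_iff edge_boundary_def dest: finite_subset)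
qed

lemma vertex_cutset_vertex_boundary:
  assumes "finite S" "x \<in> S" "S \<subseteq> V"
  shows "vertex_cutset V E x (vertex_boundary E S)"
proof -
  let ?C = "vertex_boundary E S"
  have "y \<in> S" if "(x, y) \<in> (adj {e\<in>E. e \<inter> ?C = {}})\<^sup>*" for y
    using that
  proof (induction rule: rtrancl_induct)
    case base
    then show ?case using assms by simp
  next
    case (step z y)
    then show ?case by (auto simp: adj_def edge_boundary_def vertex_boundary_def)
  qed
  then have "{y. x \<notin> ?C \<and> (x, y) \<in> (adj {e\<in>E. e \<inter> ?C = {}})\<^sup>*} \<subseteq> S" by blast
  then have "finite {y. x \<notin> ?C \<and> (x, y) \<in> (adj {e\<in>E. e \<inter> ?C = {}})\<^sup>*}"
    using assms(1) by (rule finite_subset)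
  then show ?thesis
    using assms(3) by (auto simp: vertex_cutset_iff vertex_boundary_def)
qed

text \<open>Follow the path up to its first use of \<open>e\<close>. Until then it uses no boundary
  edge, hence stays in \<open>S\<close>, and that first use starts at an endpoint of
  \<open>e\<close>. The induction therefore carries the alternative that such an endpoint was
  reached earlier.\<close>

lemma A_edge_boundary_reach:
  assumes "A_edge E x e (edge_boundary E S) \<omega>" "x \<in> S"
  shows "\<exists>u\<in>e. (x, u) \<in> (adj ({g\<in>E. \<omega> g} \<inter> Pow S))\<^sup>*"
proof -
  let ?R = "(adj ({g\<in>E. \<omega> g} \<inter> Pow S))\<^sup>*"
  have "(x, y) \<in> ?R \<or> (\<exists>u\<in>e. (x, u) \<in> ?R)"
    if "(x, y) \<in> (adj {g\<in>E. \<omega> g \<and> g \<notin> edge_boundary E S - {e}})\<^sup>*" for y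
    using that
  proof (induction rule: rtrancl_induct)
    case base
    then show ?case by simp
  next
    case (step z y)
    show ?case
    proof (cases "(x, z) \<in> ?R \<and> {z, y} \<noteq> e")
      case True
      then have "z \<in> S" using adj_rtrancl_within[of x z _ S] assms(2) by blast
      then have "{z, y} \<in> {g\<in>E. \<omega> g} \<inter> Pow S"
        using step.hyps(2) True by (auto simp: adj_def edge_boundary_def)
      then have "(x, y) \<in> ?R" by (rule adj_step[OF conjunct1[OF True]])
      then show ?thesis by blast
    next
      case False
      then show ?thesis using step.IH by blast
    qed
  qed
  moreover obtain u where "u \<in> e"
      "(x, u) \<in> (adj {g\<in>E. \<omega> g \<and> g \<notin> edge_boundary E S - {e}})\<^sup>*"
    using assms(1) unfolding A_edge_iff by blast
  ultimately show ?thesis by blast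
qed

text \<open>Follow the path up to its first visit to \<open>v\<close>. Every earlier vertex lies in
  \<open>S\<close> but not in the inner boundary, so the next edge stays inside \<open>S\<close>.
  Taking the inner boundary keeps the whole connection within \<open>S\<close>.\<close>

lemma A_vertex_boundary_reach:
  assumes "A_vertex E x v (vertex_boundary E S) \<omega>" "x \<in> S"
  shows "(x, v) \<in> (adj ({g\<in>E. \<omega> g} \<inter> Pow S))\<^sup>*"
proof -
  let ?R = "(adj ({g\<in>E. \<omega> g} \<inter> Pow S))\<^sup>*"
  have "(x, y) \<in> ?R \<or> (x, v) \<in> ?R"
    if "(x, y) \<in> (adj {g\<in>E. \<omega> g \<and> g \<inter> (vertex_boundary E S - {v}) = {}})\<^sup>*" for y
    using that
  proof (induction rule: rtrancl_induct)
    case base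
    then show ?case by simp
  next
    case (step z y)
    show ?case
    proof (cases "(x, z) \<in> ?R \<and> z \<noteq> v")
      case True
      then have "z \<in> S" using adj_rtrancl_within[of x z _ S] assms(2) by blast
      then have "{z, y} \<in> {g\<in>E. \<omega> g} \<inter> Pow S"
        using step.hyps(2) True by (auto simp: adj_def edge_boundary_def vertex_boundary_def)
      then have "(x, y) \<in> ?R" by (rule adj_step[OF conjunct1[OF True]])
      then show ?thesis by blast
    next
      case False
      then show ?thesis using step.IH by blast
    qed
  qed
  moreover have "(x, v) \<in> (adj {g\<in>E. \<omega> g \<and> g \<inter> (vertex_boundary E S - {v}) = {}})\<^sup>*"
    using assms(1) unfolding A_vertex_iff by blast
  ultimately show ?thesis by blast
qed

text \<open>Stop the open path at its first vertex in \<open>C\<close>: the part up to there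
  witnesses \<open>A_vertex\<close>. If \<open>x\<close> itself is in \<open>C\<close>, the
  one-vertex path does.\<close>

lemma reach_crosses_vertex_cutset:
  assumes "(x, y) \<in> (adj {g\<in>E. \<omega> g})\<^sup>*"
  shows "x \<notin> C \<and> (x, y) \<in> (adj {e\<in>E. e \<inter> C = {}})\<^sup>* \<or> (\<exists>v\<in>C. A_vertex E x v C \<omega>)"
proof (cases "x \<in> C")
  case True
  then have "A_vertex E x x C \<omega>" by (simp add: A_vertex_iff)
  then show ?thesis using True by blast
next
  case False
  let ?H = "{g\<in>E. \<omega> g \<and> g \<inter> C = {}}"
  have "(x, y) \<in> (adj ?H)\<^sup>* \<or> (\<exists>v\<in>C. A_vertex E x v C \<omega>)"
    using assms
  proof (induction rule: rtrancl_induct)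
    case base
    then show ?case by simp
  next
    case (step z y)
    show ?case
    proof (cases "(x, z) \<in> (adj ?H)\<^sup>*")
      case xz: True
      have z: "z \<notin> C"
        using adj_rtrancl_within[OF xz, of "- C"] False by blast
      show ?thesis
      proof (cases "y \<in> C")
        case True
        let ?H' = "{g\<in>E. \<omega> g \<and> g \<inter> (C - {y}) = {}}"
        have "(x, z) \<in> (adj ?H')\<^sup>*"
          by (rule adj_rtrancl_mono[OF \<open>(x, z) \<in> (adj ?H)\<^sup>*\<close>]) auto
        moreover have "{z, y} \<in> ?H'" using z step.hyps(2) by (auto simp: adj_def)
        ultimately have "(x, y) \<in> (adj ?H')\<^sup>*" by (rule adj_step)
        then have "A_vertex E x y C \<omega>" using False by (simp add: A_vertex_iff)
        then show ?thesis using True by blast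
      next
        case False
        then have "{z, y} \<in> ?H" using z step.hyps(2) by (auto simp: adj_def)
        then have "(x, y) \<in> (adj ?H)\<^sup>*" by (rule adj_step[OF xz])
        then show ?thesis by blast
      qed
    next
      case False
      then show ?thesis using step.IH by blast
    qed
  qed
  moreover have "(x, y) \<in> (adj {e\<in>E. e \<inter> C = {}})\<^sup>*" if "(x, y) \<in> (adj ?H)\<^sup>*"
    by (rule adj_rtrancl_mono[OF that]) auto
  ultimately show ?thesis using False by blast
qed

text \<open>Stop the open path just before its first edge in \<open>CE\<close>; that edge is open
  and one of its endpoints has been reached.\<close>

lemma reach_crosses_edge_cutset:
  assumes "(x, y) \<in> (adj {g\<in>E. \<omega> g})\<^sup>*"
  shows "(x, y) \<in> (adj (E - CE))\<^sup>* \<or> (\<exists>e\<in>CE. A_edge E x e CE \<omega>)"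
proof -
  let ?H = "{g\<in>E. \<omega> g \<and> g \<notin> CE}"
  have "(x, y) \<in> (adj ?H)\<^sup>* \<or> (\<exists>e\<in>CE. A_edge E x e CE \<omega>)"
    using assms
  proof (induction rule: rtrancl_induct)
    case base
    then show ?case by simp
  next
    case (step z y)
    show ?case
    proof (cases "(x, z) \<in> (adj ?H)\<^sup>*")
      case xz: True
      show ?thesis
      proof (cases "{z, y} \<in> CE")
        case True
        have "(x, z) \<in> (adj {g\<in>E. \<omega> g \<and> g \<notin> CE - {{z, y}}})\<^sup>*"
          by (rule adj_rtrancl_mono[OF \<open>(x, z) \<in> (adj ?H)\<^sup>*\<close>]) auto
        then have "A_edge E x {z, y} CE \<omega>"
          using step.hyps(2) by (auto simp: A_edge_iff adj_def)
        then show ?thesis using True by blast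
      next
        case False
        then have "{z, y} \<in> ?H" using step.hyps(2) by (auto simp: adj_def)
        then have "(x, y) \<in> (adj ?H)\<^sup>*" by (rule adj_step[OF xz])
        then show ?thesis by blast
      qed
    next
      case False
      then show ?thesis using step.IH by blast
    qed
  qed
  moreover have "(x, y) \<in> (adj (E - CE))\<^sup>*" if "(x, y) \<in> (adj ?H)\<^sup>*"
    by (rule adj_rtrancl_mono[OF that]) auto
  ultimately show ?thesis by blast
qed

section \<open>Percolation measures\<close>

text \<open>The union bound for unordered sums. Cutsets may be infinite, in which case an
  enumeration reduces the claim to countable subadditivity.\<close>

lemma emeasure_UN_le_infsum:
  assumes "countable I" "\<And>i. i \<in> I \<Longrightarrow> A i \<in> sets M"
  shows "emeasure M (\<Union>i\<in>I. A i) \<le> infsum (\<lambda>i. emeasure M (A i)) I"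
proof (cases "finite I")
  case True
  then show ?thesis
    using assms(2) by (auto intro!: emeasure_subadditive_finite)
next
  case False
  let ?h = "from_nat_into I"
  have bij: "bij_betw ?h UNIV I"
    by (rule bij_betw_from_nat_into[OF assms(1) False])
  then have "?h ` UNIV = I" by (simp add: bij_betw_def)
  then have "(\<Union>i\<in>I. A i) = (\<Union>n. A (?h n))"
    by (metis image_image)
  also have "emeasure M \<dots> \<le> (\<Sum>n. emeasure M (A (?h n)))"
    using assms(2) bij by (intro emeasure_subadditive_countably) (auto simp: bij_betw_def)
  also have "\<dots> = infsum (\<lambda>n. emeasure M (A (?h n))) UNIV"
    by (intro sums_unique[symmetric] has_sum_imp_sums has_sum_infsum nonneg_summable_on_complete) simp
  also have "\<dots> = infsum (\<lambda>i. emeasure M (A i)) I"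
    by (rule infsum_reindex_bij_betw[OF bij])
  finally show ?thesis .
qed

lemma prob_space_perc: "prob_space (perc E p)"
  unfolding perc_def by (intro prob_space_PiM) (simp add: measure_pmf.prob_space_axioms)

lemma pred_edge: "e \<in> E \<Longrightarrow> Measurable.pred (perc E p) (\<lambda>\<omega>. \<omega> e)"
  unfolding perc_def by measurable

text \<open>The bridge from the infinite product measure to \<open>bexp\<close>: an event determined
  by the finite set \<open>F\<close> is a finite disjoint union of elementary cylinders, one for
  each set \<open>T\<close> of open edges.\<close>

lemma measure_perc_cylinder:
  assumes "finite F" "F \<subseteq> E" "0 \<le> p" "p \<le> 1"
  shows "measure (perc E p) {\<omega>\<in>space (perc E p). P {e\<in>F. \<omega> e}} = bexp F p (\<lambda>T. of_bool (P T))"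
    and "{\<omega>\<in>space (perc E p). P {e\<in>F. \<omega> e}} \<in> sets (perc E p)"
proof -
  interpret prob_space "perc E p" by (rule prob_space_perc)
  interpret P: product_prob_space "\<lambda>_. measure_pmf (bernoulli_pmf p)" E
    by unfold_locales
  let ?cyl = "\<lambda>T. {\<omega>\<in>space (perc E p). {e\<in>F. \<omega> e} = T}"
  let ?w = "\<lambda>T. p ^ card T * (1 - p) ^ card (F - T)"
  have sets: "?cyl T \<in> sets (perc E p)" if "T \<subseteq> F" for T
  proof -
    have "?cyl T = {\<omega>\<in>space (perc E p). \<forall>e\<in>F. \<omega> e = (e \<in> T)}" using that by auto
    also have "\<dots> \<in> sets (perc E p)"
      using assms(1,2) pred_edge[of _ E p] unfolding pred_def[symmetric]
      by (intro pred_intros_finite pred_intros_logic) auto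
    finally show ?thesis .
  qed
  have meas: "measure (perc E p) (?cyl T) = ?w T" if T: "T \<subseteq> F" for T
  proof -
    \<comment> \<open>Here \<open>{e \<in> T}\<close> is a singleton of truth values: the state of
      \<open>e\<close> is prescribed to be open exactly when \<open>e\<close> is in
      \<open>T\<close>.\<close>
    have "?cyl T = prod_emb E (\<lambda>_. measure_pmf (bernoulli_pmf p)) F (Pi\<^sub>E F (\<lambda>e. {e \<in> T}))"
      using T assms(2) by (auto simp: perc_def prod_emb_iff space_PiM PiE_iff)
    then have "measure (perc E p) (?cyl T) =
        (\<Prod>e\<in>F. measure (measure_pmf (bernoulli_pmf p)) {e \<in> T})"
      using assms(1,2) by (simp add: perc_def P.measure_PiM_emb)
    also have "\<dots> = (\<Prod>e\<in>F. if e \<in> T then p else 1 - p)"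
      using assms(3,4) by (intro prod.cong) (auto simp: measure_pmf_single)
    also have "\<dots> = ?w T"
    proof -
      have "F \<inter> T = T" "F \<inter> - T = F - T" using T by auto
      then show ?thesis using assms(1) by (simp add: prod.If_cases)
    qed
    finally show ?thesis .
  qed
  have eq: "{\<omega>\<in>space (perc E p). P {e\<in>F. \<omega> e}} = (\<Union>T\<in>{T\<in>Pow F. P T}. ?cyl T)"
    by auto
  have fin: "finite {T\<in>Pow F. P T}" using assms(1) by simp
  show "{\<omega>\<in>space (perc E p). P {e\<in>F. \<omega> e}} \<in> sets (perc E p)"
    unfolding eq using fin sets by (intro sets.finite_UN) auto
  have "measure (perc E p) (\<Union>T\<in>{T\<in>Pow F. P T}. ?cyl T) =
      (\<Sum>T\<in>{T\<in>Pow F. P T}. measure (perc E p) (?cyl T))"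
    using fin sets by (intro finite_measure_finite_Union) (auto simp: disjoint_family_on_def)
  also have "\<dots> = (\<Sum>T\<in>{T\<in>Pow F. P T}. ?w T)"
    using meas by (intro sum.cong) auto
  also have "\<dots> = bexp F p (\<lambda>T. of_bool (P T))"
    using assms(1) unfolding bexp_def by (intro sum.mono_neutral_cong_left) auto
  finally show "measure (perc E p) {\<omega>\<in>space (perc E p). P {e\<in>F. \<omega> e}} = bexp F p (\<lambda>T. of_bool (P T))"
    unfolding eq .
qed

text \<open>Makes suitable cutset sums vanish at parameter 0, so that the suprema defining the
  cutset thresholds range over nonempty sets.\<close>

lemma AE_perc_zero_closed:
  assumes "countable E"
  shows "AE \<omega> in perc E 0. \<forall>e\<in>E. \<not> \<omega> e"
proof (rule AE_ball_countable'[OF _ assms])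
  fix e assume e: "e \<in> E"
  interpret prob_space "perc E 0" by (rule prob_space_perc)
  have "measure (perc E 0) {\<omega>\<in>space (perc E 0). e \<in> {g\<in>{e}. \<omega> g}} = bexp {e} 0 (\<lambda>T. of_bool (e \<in> T))"
    using e by (intro measure_perc_cylinder) auto
  also have "\<dots> = 0"
    by (simp add: bexp_insert)
  finally have "measure (perc E 0) {\<omega>\<in>space (perc E 0). \<omega> e} = 0" by simp
  then show "AE \<omega> in perc E 0. \<not> \<omega> e"
    using pred_edge[OF e, of 0] by (subst (asm) prob_eq_0) (auto simp: pred_def)
qed

text \<open>A path out of \<open>B\<close> can be cut at its first vertex outside \<open>B\<close>,
  and all edges up to there meet \<open>B\<close>. For a finite ball this leaves finitely many
  edges, so confinement is a cylinder event.\<close>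

lemma confined_touching:
  "confined B {g\<in>H. g \<inter> B \<noteq> {}} = confined B H"
proof
  show "confined B H \<subseteq> confined B {g\<in>H. g \<inter> B \<noteq> {}}"
    by (rule confined_mono) auto
  have "v \<notin> confined B {g\<in>H. g \<inter> B \<noteq> {}}" if "(v, y) \<in> (adj H)\<^sup>*" "y \<notin> B" for v y
    using that
  proof (induction rule: converse_rtrancl_induct)
    case base
    then show ?case by (meson confined_subset subsetD)
  next
    case (step v z)
    show ?case
    proof (cases "v \<in> B")
      case True
      then have vz: "{v, z} \<in> {g\<in>H. g \<inter> B \<noteq> {}}"
        using step.hyps(1) by (auto simp: adj_def)
      obtain y' where y': "(z, y') \<in> (adj {g\<in>H. g \<inter> B \<noteq> {}})\<^sup>*" "y' \<notin> B"
        using step.IH[OF step.prems] unfolding confined_def by blast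
      have "(v, y') \<in> (adj {g\<in>H. g \<inter> B \<noteq> {}})\<^sup>*"
        by (rule adj_step_converse[OF vz y'(1)])
      then show ?thesis using \<open>y' \<notin> B\<close> unfolding confined_def by blast
    next
      case False
      then show ?thesis by (meson confined_subset subsetD)
    qed
  qed
  then show "confined B {g\<in>H. g \<inter> B \<noteq> {}} \<subseteq> confined B H"
    unfolding confined_def[of B H] by blast
qed

text \<open>If a zero \<open>q\<close> of \<open>\<theta>\<close> exceeded the supremum for
  \<open>\<Phi>\<close>, a point \<open>p\<close> strictly between them would have
  \<open>\<Phi> p \<noteq> 0\<close> and force \<open>\<theta> q \<noteq> 0\<close>. The strict gap
  is needed because the exponential bound is trivial at \<open>q = p\<close>.\<close>

lemma Sup_threshold_eq:
  fixes \<Phi> :: "real \<Rightarrow> 'b::zero" and \<theta> :: "real \<Rightarrow> real"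
  assumes "\<Phi> 0 = 0"
    and "\<And>p. 0 \<le> p \<Longrightarrow> p \<le> 1 \<Longrightarrow> \<Phi> p = 0 \<Longrightarrow> \<theta> p = 0"
    and "\<And>p q. 0 \<le> p \<Longrightarrow> p < q \<Longrightarrow> q \<le> 1 \<Longrightarrow> \<Phi> p \<noteq> 0 \<Longrightarrow> \<theta> q \<noteq> 0"
  shows "Sup {p. 0 \<le> p \<and> p \<le> 1 \<and> \<Phi> p = 0} = Sup {p. 0 \<le> p \<and> p \<le> 1 \<and> \<theta> p = 0}"
proof (rule antisym)
  let ?A = "{p. 0 \<le> p \<and> p \<le> 1 \<and> \<Phi> p = 0}" and ?B = "{p. 0 \<le> p \<and> p \<le> 1 \<and> \<theta> p = 0}"
  have A: "0 \<in> ?A" "bdd_above ?A" and sub: "?A \<subseteq> ?B" and B: "bdd_above ?B"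
    using assms(1,2) by (auto intro!: bdd_aboveI[of _ 1])
  show "Sup ?A \<le> Sup ?B"
    using A B sub by (intro cSup_subset_mono) auto
  show "Sup ?B \<le> Sup ?A"
  proof (rule cSup_least)
    show "?B \<noteq> {}" using A sub by blast
    fix q assume q: "q \<in> ?B"
    show "q \<le> Sup ?A"
    proof (rule ccontr)
      assume "\<not> q \<le> Sup ?A"
      then obtain p where p: "Sup ?A < p" "p < q" using dense by (meson not_le)
      moreover have "0 \<le> Sup ?A" using A by (intro cSup_upper)
      ultimately have "p \<notin> ?A" using cSup_upper[OF _ A(2)] by fastforce
      then show False
        using assms(3)[of p q] p q \<open>0 \<le> Sup ?A\<close> by auto
    qed
  qed
qed

section \<open>Comparison of the thresholds\<close>

locale percolation_graph =
  fixes V :: "'a set" and E :: "'a set set" and x :: 'a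
  assumes simple: "simple_graph V E"
    and loc_fin: "locally_finite V E"
    and conn: "graph_connected V E"
    and root: "x \<in> V"
begin

section \<open>Finiteness, countability and measurability\<close>

lemma edge_cases: "e \<in> E \<Longrightarrow> \<exists>u v. e = {u, v}"
  using simple unfolding simple_graph_def by blast

lemma edge_subset: "e \<in> E \<Longrightarrow> e \<subseteq> V"
  using simple by (fastforce simp: simple_graph_def)

lemma edge_nonempty: "e \<in> E \<Longrightarrow> e \<noteq> {}"
  using edge_cases by blast

lemma finite_touching: "finite S \<Longrightarrow> S \<subseteq> V \<Longrightarrow> finite {e\<in>E. e \<inter> S \<noteq> {}}"
proof -
  assume "finite S" "S \<subseteq> V"
  then have "finite (\<Union>v\<in>S. {e\<in>E. v \<in> e})"
    using loc_fin by (auto simp: locally_finite_def)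
  then show ?thesis by (rule finite_subset[rotated]) auto
qed

lemma gball_subset: "gball E x n \<subseteq> V"
proof (induction n)
  case 0
  then show ?case using root by simp
next
  case (Suc n)
  then show ?case using gball_Suc_subset[of E x n] edge_subset by blast
qed

lemma finite_gball: "finite (gball E x n)"
proof (induction n)
  case 0
  then show ?case by simp
next
  case (Suc n)
  have "finite e" if "e \<in> E" for e
    using edge_cases[OF that] by auto
  then have "finite (gball E x n \<union> \<Union> {e\<in>E. e \<inter> gball E x n \<noteq> {}})"
    using Suc finite_touching[OF Suc gball_subset] by auto
  then show ?case
    by (rule finite_subset[OF gball_Suc_subset])
qed

text \<open>By connectedness the finite balls around \<open>x\<close> exhaust
  \<open>V\<close>.\<close>

lemma countable_V: "countable V"
proof -
  have "y \<in> (\<Union>n. gball E x n)" if "y \<in> V" for y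
    using conn root that rtrancl_in_gball[of x y E] unfolding graph_connected_def walk_rtrancl by auto
  then have "V \<subseteq> (\<Union>n. gball E x n)" by blast
  moreover have "countable (\<Union>n. gball E x n)"
    using finite_gball by (intro countable_UN) (auto intro: countable_finite)
  ultimately show ?thesis by (rule countable_subset)
qed

lemma countable_E: "countable E"
proof -
  have "E \<subseteq> {e. e \<subseteq> V \<and> finite e}"
  proof
    fix e assume "e \<in> E"
    then show "e \<in> {e. e \<subseteq> V \<and> finite e}"
      using edge_subset[of e] edge_cases[of e] by auto
  qed
  moreover have "countable {e. e \<subseteq> V \<and> finite e}"
    using countable_Collect_finite_subset[OF countable_V] by (simp add: conj_commute)
  ultimately show ?thesis by (rule countable_subset)
qed

lemma finite_edge_boundary_E: "finite S \<Longrightarrow> S \<subseteq> V \<Longrightarrow> finite (edge_boundary E S)"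
  by (rule finite_subset[OF _ finite_touching[of S]]) (auto simp: edge_boundary_def)

text \<open>Split off the last step: its starting vertex ranges over a countable set. The filter
  \<open>Q\<close> covers the edge restrictions in all the crossing events at once.\<close>

lemma pred_relpow:
  "Measurable.pred (perc E p) (\<lambda>\<omega>. (u, v) \<in> adj {g\<in>E. \<omega> g \<and> Q g} ^^ n)"
proof (induction n arbitrary: v)
  case 0
  then show ?case by simp
next
  case (Suc n)
  have eq: "(u, v) \<in> adj {g\<in>E. \<omega> g \<and> Q g} ^^ Suc n \<longleftrightarrow>
      (\<exists>w\<in>{w\<in>V. {w, v} \<in> E \<and> Q {w, v}}. (u, w) \<in> adj {g\<in>E. \<omega> g \<and> Q g} ^^ n \<and> \<omega> {w, v})" for \<omega>
    using edge_subset by (auto simp: adj_def relcomp_unfold)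
  have "countable {w\<in>V. {w, v} \<in> E \<and> Q {w, v}}"
    using countable_V by (rule countable_subset[rotated]) auto
  moreover have "Measurable.pred (perc E p) (\<lambda>\<omega>. (u, w) \<in> adj {g\<in>E. \<omega> g \<and> Q g} ^^ n \<and> \<omega> {w, v})"
    if "{w, v} \<in> E" for w
    using that by (intro pred_intros_logic Suc.IH pred_edge)
  ultimately show ?case
    unfolding eq pred_def by (intro sets.sets_Collect_countable_Ex') auto
qed

lemma pred_reach:
  "Measurable.pred (perc E p) (\<lambda>\<omega>. (u, v) \<in> (adj {g\<in>E. \<omega> g \<and> Q g})\<^sup>*)"
  unfolding rtrancl_power by (intro pred_intros_countable pred_relpow)

lemma sets_A_vertex: "{\<omega>\<in>space (perc E p). A_vertex E x v C \<omega>} \<in> sets (perc E p)"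
proof -
  have "Measurable.pred (perc E p) (\<lambda>\<omega>. x \<notin> C - {v} \<and>
      (x, v) \<in> (adj {g\<in>E. \<omega> g \<and> g \<inter> (C - {v}) = {}})\<^sup>*)"
    by (rule pred_intros_logic(3)[OF measurable_const pred_reach]) simp
  then show ?thesis unfolding A_vertex_iff pred_def .
qed

lemma sets_A_edge:
  assumes "e \<in> E"
  shows "{\<omega>\<in>space (perc E p). A_edge E x e CE \<omega>} \<in> sets (perc E p)"
proof -
  have "finite e" using edge_cases[OF assms] by auto
  let ?R = "\<lambda>u \<omega>. (x, u) \<in> (adj {g\<in>E. \<omega> g \<and> g \<notin> CE - {e}})\<^sup>*"
  have "Measurable.pred (perc E p) (?R u)" for u
    by (rule pred_reach)
  with \<open>finite e\<close> have "Measurable.pred (perc E p) (\<lambda>\<omega>. \<exists>u\<in>e. ?R u \<omega>)"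
    by (rule pred_intros_finite(4))
  with pred_edge[OF assms] have "Measurable.pred (perc E p) (\<lambda>\<omega>. \<omega> e \<and> (\<exists>u\<in>e. ?R u \<omega>))"
    by (rule pred_intros_logic(3))
  then show ?thesis unfolding A_edge_iff pred_def .
qed

section \<open>The percolation probability is at most every cutset sum\<close>

lemma escapes_finite:
  assumes "connects_to_infinity E x \<omega>" "finite K" "\<And>y. y \<in> K \<Longrightarrow> (x, y) \<in> (adj E)\<^sup>*"
  obtains y where "y \<notin> K" "(x, y) \<in> (adj {g\<in>E. \<omega> g})\<^sup>*"
proof -
  obtain n where "K \<subseteq> gball E x n"
    using finite_subset_gball[OF assms(2,3)] by metis
  moreover obtain y where "y \<notin> gball E x n" "(x, y) \<in> (adj {g\<in>E. \<omega> g})\<^sup>*"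
    using assms(1) unfolding connects_to_infinity_iff by metis
  ultimately show ?thesis using that by blast
qed

text \<open>An infinite cluster leaves the finite component of \<open>x\<close> off
  \<open>C\<close>, and the open path that does so has to meet \<open>C\<close>.\<close>

lemma connects_crosses_vertex_cutset:
  assumes "connects_to_infinity E x \<omega>" "vertex_cutset V E x C"
  shows "\<exists>v\<in>C. A_vertex E x v C \<omega>"
proof -
  let ?K = "{y. x \<notin> C \<and> (x, y) \<in> (adj {e\<in>E. e \<inter> C = {}})\<^sup>*}"
  have K: "finite ?K" using assms(2) unfolding vertex_cutset_iff by blast
  have "(x, y) \<in> (adj E)\<^sup>*" if "y \<in> ?K" for y
    using that adj_rtrancl_mono[of x y "{e\<in>E. e \<inter> C = {}}" E] by auto
  with assms(1) K obtain y where "y \<notin> ?K" "(x, y) \<in> (adj {g\<in>E. \<omega> g})\<^sup>*"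
    by (rule escapes_finite)
  then show ?thesis
    using reach_crosses_vertex_cutset[of x y E \<omega> C] by blast
qed

lemma connects_crosses_edge_cutset:
  assumes "connects_to_infinity E x \<omega>" "edge_cutset V E x CE"
  shows "\<exists>e\<in>CE. A_edge E x e CE \<omega>"
proof -
  let ?K = "{y. (x, y) \<in> (adj (E - CE))\<^sup>*}"
  have K: "finite ?K" using assms(2) unfolding edge_cutset_iff by blast
  have "(x, y) \<in> (adj E)\<^sup>*" if "y \<in> ?K" for y
    using that adj_rtrancl_mono[of x y "E - CE" E] by auto
  with assms(1) K obtain y where "y \<notin> ?K" "(x, y) \<in> (adj {g\<in>E. \<omega> g})\<^sup>*"
    by (rule escapes_finite)
  then show ?thesis
    using reach_crosses_edge_cutset[of x y E \<omega> CE] by blast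
qed

lemma emeasure_connects_le_vertex_cutset:
  assumes "vertex_cutset V E x C"
  shows "emeasure (perc E p) {\<omega>\<in>space (perc E p). connects_to_infinity E x \<omega>} \<le>
    infsum (\<lambda>v. emeasure (perc E p) {\<omega>\<in>space (perc E p). A_vertex E x v C \<omega>}) C"
proof -
  have C: "countable C"
    using assms countable_V unfolding vertex_cutset_iff by (blast intro: countable_subset)
  have "emeasure (perc E p) {\<omega>\<in>space (perc E p). connects_to_infinity E x \<omega>} \<le>
      emeasure (perc E p) (\<Union>v\<in>C. {\<omega>\<in>space (perc E p). A_vertex E x v C \<omega>})"
    using connects_crosses_vertex_cutset[OF _ assms] sets_A_vertex C
    by (intro emeasure_mono sets.countable_UN'') auto
  also have "\<dots> \<le> infsum (\<lambda>v. emeasure (perc E p) {\<omega>\<in>space (perc E p). A_vertex E x v C \<omega>}) C"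
    by (intro emeasure_UN_le_infsum C sets_A_vertex)
  finally show ?thesis .
qed

lemma emeasure_connects_le_edge_cutset:
  assumes "edge_cutset V E x CE"
  shows "emeasure (perc E p) {\<omega>\<in>space (perc E p). connects_to_infinity E x \<omega>} \<le>
    infsum (\<lambda>e. emeasure (perc E p) {\<omega>\<in>space (perc E p). A_edge E x e CE \<omega>}) CE"
proof -
  have CE: "CE \<subseteq> E" using assms unfolding edge_cutset_iff by blast
  then have C: "countable CE" using countable_E by (rule countable_subset)
  have "emeasure (perc E p) {\<omega>\<in>space (perc E p). connects_to_infinity E x \<omega>} \<le>
      emeasure (perc E p) (\<Union>e\<in>CE. {\<omega>\<in>space (perc E p). A_edge E x e CE \<omega>})"
    using connects_crosses_edge_cutset[OF _ assms] sets_A_edge C CE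
    by (intro emeasure_mono sets.countable_UN'') auto
  also have "\<dots> \<le> infsum (\<lambda>e. emeasure (perc E p) {\<omega>\<in>space (perc E p). A_edge E x e CE \<omega>}) CE"
    using CE by (intro emeasure_UN_le_infsum C sets_A_edge) auto
  finally show ?thesis .
qed

section \<open>Percolation strictly above a parameter with cutset sums bounded below\<close>

definition inner_reach :: "real \<Rightarrow> 'a set \<Rightarrow> 'a set \<Rightarrow> ('a set \<Rightarrow> bool) set" where
  "inner_reach p S e = {\<omega>\<in>space (perc E p). \<exists>u\<in>e. (x, u) \<in> (adj ({g\<in>E. \<omega> g} \<inter> Pow S))\<^sup>*}"

lemma inner_reach_cylinder:
  assumes "finite B" "B \<subseteq> V" "S \<subseteq> B" "0 \<le> p" "p \<le> 1"
  shows "measure (perc E p) (inner_reach p S e) =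
      bexp {g\<in>E. g \<inter> B \<noteq> {}} p (\<lambda>\<omega>. of_bool (\<exists>u\<in>e. (x, u) \<in> (adj (\<omega> \<inter> Pow S))\<^sup>*))"
    and "inner_reach p S e \<in> sets (perc E p)"
proof -
  let ?F = "{g\<in>E. g \<inter> B \<noteq> {}}"
  \<comment> \<open>An edge inside \<open>S\<close> is nonempty and \<open>S \<subseteq> B\<close>,
    so it meets \<open>B\<close>; restricting to the finite set \<open>?F\<close> loses no edge
    relevant to the event.\<close>
  have "{g\<in>E. \<omega> g} \<inter> Pow S = {g\<in>?F. \<omega> g} \<inter> Pow S" for \<omega>
    using assms(3) edge_nonempty by blast
  then have eq: "inner_reach p S e =
      {\<omega>\<in>space (perc E p). \<exists>u\<in>e. (x, u) \<in> (adj ({g\<in>?F. \<omega> g} \<inter> Pow S))\<^sup>*}"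
    by (simp add: inner_reach_def)
  show "measure (perc E p) (inner_reach p S e) =
      bexp ?F p (\<lambda>\<omega>. of_bool (\<exists>u\<in>e. (x, u) \<in> (adj (\<omega> \<inter> Pow S))\<^sup>*))"
    unfolding eq using assms finite_touching[OF assms(1,2)]
    by (intro measure_perc_cylinder(1)[where P = "\<lambda>T. \<exists>u\<in>e. (x, u) \<in> (adj (T \<inter> Pow S))\<^sup>*"]) auto
  show "inner_reach p S e \<in> sets (perc E p)"
    unfolding eq using assms finite_touching[OF assms(1,2)]
    by (intro measure_perc_cylinder(2)[where P = "\<lambda>T. \<exists>u\<in>e. (x, u) \<in> (adj (T \<inter> Pow S))\<^sup>*"]) auto
qed

text \<open>The sum in the hypothesis is the functional of Duminil-Copin and Tassion for
  \<open>S\<close>, without its factor \<open>p\<close>. The probability of leaving the ball of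
  radius \<open>n\<close> is at least \<open>1 - exp (- c * (q - p))\<close> for every
  \<open>n\<close>; these events decrease to percolation, and continuity from above preserves the
  bound.\<close>

lemma measure_connects_pos:
  assumes p: "0 \<le> p" "p < q" "q \<le> 1" and "0 < c"
    and c: "\<And>S. finite S \<Longrightarrow> x \<in> S \<Longrightarrow> S \<subseteq> V \<Longrightarrow>
        c \<le> (\<Sum>e\<in>edge_boundary E S. measure (perc E p) (inner_reach p S e))"
  shows "measure (perc E q) {\<omega>\<in>space (perc E q). connects_to_infinity E x \<omega>} \<noteq> 0"
proof -
  interpret prob_space "perc E q" by (rule prob_space_perc)
  let ?B = "gball E x" and ?F = "\<lambda>n. {g\<in>E. g \<inter> gball E x n \<noteq> {}}"
  let ?Ev = "\<lambda>n. {\<omega>\<in>space (perc E q). x \<notin> confined (?B n) {g\<in>E. \<omega> g}}"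
  have fin: "finite (?F n)" for n
    by (rule finite_touching[OF finite_gball gball_subset])
  have Ev: "?Ev n = {\<omega>\<in>space (perc E q). x \<notin> confined (?B n) {g\<in>?F n. \<omega> g}}" for n
  proof -
    have "{g\<in>?F n. \<omega> g} = {g\<in>{g\<in>E. \<omega> g}. g \<inter> ?B n \<noteq> {}}" for \<omega> by auto
    then show ?thesis by (simp only: confined_touching)
  qed
  have sets: "?Ev n \<in> sets (perc E q)" for n
    unfolding Ev using p fin by (intro measure_perc_cylinder(2)) auto
  have lower: "1 - exp (- c * (q - p)) \<le> measure (perc E q) (?Ev n)" for n
  proof -
    have "bexp (?F n) q (\<lambda>\<omega>. of_bool (x \<in> confined (?B n) \<omega>)) \<le> exp (- c * (q - p))"
    proof (rule confined_exp_bound[OF fin finite_gball])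
      fix S assume S: "x \<in> S" "S \<subseteq> ?B n"
      then have "c \<le> (\<Sum>e\<in>edge_boundary E S. measure (perc E p) (inner_reach p S e))"
        using gball_subset finite_gball by (intro c) (auto intro: finite_subset)
      \<comment> \<open>Every boundary edge of \<open>S\<close> meets \<open>S\<close>, hence the
        ball containing it.\<close>
      also have "edge_boundary E S = edge_boundary (?F n) S"
        using S by (auto simp: edge_boundary_def)
      finally show "c \<le> (\<Sum>e\<in>edge_boundary (?F n) S.
          bexp (?F n) p (\<lambda>\<omega>. of_bool (\<exists>u\<in>e. (x, u) \<in> (adj (\<omega> \<inter> Pow S))\<^sup>*)))"
        using inner_reach_cylinder(1)[OF finite_gball gball_subset S(2)] p by simp
    qed (use p edge_cases in auto)
    moreover have "measure (perc E q) (?Ev n) = bexp (?F n) q (\<lambda>\<omega>. of_bool (x \<notin> confined (?B n) \<omega>))"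
      unfolding Ev using p fin by (intro measure_perc_cylinder(1)) auto
    moreover have "\<dots> = 1 - bexp (?F n) q (\<lambda>\<omega>. of_bool (x \<in> confined (?B n) \<omega>))"
      using bexp_diff[of "?F n" q "\<lambda>_. 1" "\<lambda>\<omega>. of_bool (x \<in> confined (?B n) \<omega>)"]
      by (simp add: of_bool_not_iff bexp_one[OF fin])
    ultimately show ?thesis by simp
  qed
  have conn: "{\<omega>\<in>space (perc E q). connects_to_infinity E x \<omega>} = (\<Inter>n. ?Ev n)"
    unfolding connects_to_infinity_iff by (auto simp: confined_def)
  have "confined (?B m) \<omega> \<subseteq> confined (?B n) \<omega>" if "m \<le> n" for m n \<omega>
    using gball_mono[OF that, of E x] unfolding confined_def by blast
  then have "decseq ?Ev"
    unfolding decseq_def by blast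
  then have "(\<lambda>n. measure (perc E q) (?Ev n)) \<longlonglongrightarrow> measure (perc E q) (\<Inter>n. ?Ev n)"
    using sets by (intro finite_Lim_measure_decseq) auto
  then have "1 - exp (- c * (q - p)) \<le> measure (perc E q) (\<Inter>n. ?Ev n)"
    using lower by (intro LIMSEQ_le_const) auto
  moreover have "exp (- c * (q - p)) < 1"
    using \<open>0 < c\<close> p by (simp add: mult_pos_pos)
  ultimately show ?thesis unfolding conn by linarith
qed

lemma sum_A_edge_le:
  assumes S: "finite S" "x \<in> S" "S \<subseteq> V" and p: "0 \<le> p" "p \<le> 1"
  shows "infsum (\<lambda>e. emeasure (perc E p) {\<omega>\<in>space (perc E p). A_edge E x e (edge_boundary E S) \<omega>})
      (edge_boundary E S) \<le>
    ennreal (\<Sum>e\<in>edge_boundary E S. measure (perc E p) (inner_reach p S e))"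
proof -
  interpret prob_space "perc E p" by (rule prob_space_perc)
  have "infsum (\<lambda>e. emeasure (perc E p) {\<omega>\<in>space (perc E p). A_edge E x e (edge_boundary E S) \<omega>})
      (edge_boundary E S) =
    (\<Sum>e\<in>edge_boundary E S. emeasure (perc E p) {\<omega>\<in>space (perc E p). A_edge E x e (edge_boundary E S) \<omega>})"
    using finite_edge_boundary_E[OF S(1,3)] by (rule infsum_finite)
  also have "\<dots> \<le> (\<Sum>e\<in>edge_boundary E S. emeasure (perc E p) (inner_reach p S e))"
    using A_edge_boundary_reach[OF _ S(2)] inner_reach_cylinder(2)[OF S(1,3) subset_refl p]
    by (intro sum_mono emeasure_mono) (auto simp: inner_reach_def)
  also have "\<dots> = ennreal (\<Sum>e\<in>edge_boundary E S. measure (perc E p) (inner_reach p S e))"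
    by (simp add: emeasure_eq_measure sum_ennreal)
  finally show ?thesis .
qed

text \<open>Choose for each boundary vertex \<open>v\<close> a boundary edge \<open>h v\<close>
  containing it. A boundary edge has only one endpoint in \<open>S\<close>, so \<open>h\<close> is
  injective and the vertex sum is dominated by the edge sum.\<close>

lemma sum_A_vertex_le:
  assumes S: "finite S" "x \<in> S" "S \<subseteq> V" and p: "0 \<le> p" "p \<le> 1"
  shows "infsum (\<lambda>v. emeasure (perc E p) {\<omega>\<in>space (perc E p). A_vertex E x v (vertex_boundary E S) \<omega>})
      (vertex_boundary E S) \<le>
    ennreal (\<Sum>e\<in>edge_boundary E S. measure (perc E p) (inner_reach p S e))"
proof -
  interpret prob_space "perc E p" by (rule prob_space_perc)
  let ?C = "vertex_boundary E S"
  have "\<forall>v\<in>?C. \<exists>e. e \<in> edge_boundary E S \<and> v \<in> e"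
    by (auto simp: vertex_boundary_def)
  then obtain h where "\<forall>v\<in>?C. h v \<in> edge_boundary E S \<and> v \<in> h v"
    by (rule bchoice[THEN exE])
  then have h: "h v \<in> edge_boundary E S \<and> v \<in> h v" if "v \<in> ?C" for v
    using that by simp
  have inj: "inj_on h ?C"
  proof (rule inj_onI)
    fix u v assume uv: "u \<in> ?C" "v \<in> ?C" "h u = h v"
    then have "u \<in> S" "v \<in> S" "u \<in> h u" "v \<in> h u" "h u \<in> edge_boundary E S"
      using h[of u] h[of v] by (auto simp: vertex_boundary_def)
    moreover obtain a b where "h u = {a, b}"
      using edge_cases[of "h u"] \<open>h u \<in> edge_boundary E S\<close> by (auto simp: edge_boundary_def)
    ultimately show "u = v"
      by (auto simp: edge_boundary_def)
  qed
  have fin: "finite ?C" using S(1) by (simp add: vertex_boundary_def)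
  have "infsum (\<lambda>v. emeasure (perc E p) {\<omega>\<in>space (perc E p). A_vertex E x v ?C \<omega>}) ?C =
    (\<Sum>v\<in>?C. emeasure (perc E p) {\<omega>\<in>space (perc E p). A_vertex E x v ?C \<omega>})"
    using fin by (rule infsum_finite)
  also have "\<dots> \<le> (\<Sum>v\<in>?C. emeasure (perc E p) (inner_reach p S (h v)))"
  proof (intro sum_mono emeasure_mono inner_reach_cylinder(2)[OF S(1,3) subset_refl p])
    fix v assume "v \<in> ?C"
    then show "{\<omega>\<in>space (perc E p). A_vertex E x v ?C \<omega>} \<subseteq> inner_reach p S (h v)"
      using A_vertex_boundary_reach[OF _ S(2)] h unfolding inner_reach_def by blast
  qed
  also have "\<dots> = (\<Sum>e\<in>h ` ?C. emeasure (perc E p) (inner_reach p S e))"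
    by (simp add: sum.reindex[OF inj])
  also have "\<dots> \<le> (\<Sum>e\<in>edge_boundary E S. emeasure (perc E p) (inner_reach p S e))"
    using h finite_edge_boundary_E[OF S(1,3)] by (intro sum_mono2) auto
  also have "\<dots> = ennreal (\<Sum>e\<in>edge_boundary E S. measure (perc E p) (inner_reach p S e))"
    by (simp add: emeasure_eq_measure sum_ennreal)
  finally show ?thesis .
qed

lemma percolates_above:
  assumes p: "0 \<le> p" "p < q" "q \<le> 1" and "I \<noteq> 0"
    and I: "\<And>S. finite S \<Longrightarrow> x \<in> S \<Longrightarrow> S \<subseteq> V \<Longrightarrow>
        I \<le> ennreal (\<Sum>e\<in>edge_boundary E S. measure (perc E p) (inner_reach p S e))"
  shows "measure (perc E q) {\<omega>\<in>space (perc E q). connects_to_infinity E x \<omega>} \<noteq> 0"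
proof (rule measure_connects_pos[OF p])
  \<comment> \<open>Testing with \<open>S = {x}\<close> makes the extended value \<open>I\<close>
    finite, so \<open>enn2real I\<close> is a positive real constant that can serve as
    \<open>c\<close>.\<close>
  have "I < \<top>" using I[of "{x}"] root by (auto intro: le_less_trans)
  then show "0 < enn2real I" using \<open>I \<noteq> 0\<close> by (simp add: enn2real_positive_iff zero_less_iff_neq_zero)
  show "enn2real I \<le> (\<Sum>e\<in>edge_boundary E S. measure (perc E p) (inner_reach p S e))"
    if "finite S" "x \<in> S" "S \<subseteq> V" for S
    using I[OF that] by (intro enn2real_leI sum_nonneg) auto
qed

section \<open>Equality of the thresholds\<close>

lemma p_cut_E_eq_p_c: "p_cut_E V E x = p_c V E x"
  unfolding p_cut_E_def p_c_def
proof (rule Sup_threshold_eq)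
  let ?s = "\<lambda>p CE. infsum (\<lambda>e. emeasure (perc E p) {\<omega>\<in>space (perc E p). A_edge E x e CE \<omega>}) CE"
  let ?\<theta> = "\<lambda>p. measure (perc E p) {\<omega>\<in>space (perc E p). connects_to_infinity E x \<omega>}"
  have cut: "edge_cutset V E x (edge_boundary E S)" if "finite S" "x \<in> S" for S
    using that by (rule edge_cutset_edge_boundary)
  \<comment> \<open>Witness at parameter 0: \<open>A_edge\<close> requires the edge itself to be
    open, so each summand over the edges at \<open>x\<close> vanishes.\<close>
  let ?C = "edge_boundary E {x}"
  have "emeasure (perc E 0) {\<omega>\<in>space (perc E 0). A_edge E x e ?C \<omega>} = 0" if "e \<in> ?C" for e
    using AE_perc_zero_closed[OF countable_E] that
    by (intro emeasure_eq_0_AE) (auto simp: A_edge_iff edge_boundary_def)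
  then have "?s 0 ?C = 0" by (intro infsum_0) auto
  then show "(INF CE\<in>{CE. edge_cutset V E x CE}. ?s 0 CE) = 0"
    using cut[of "{x}"] INF_lower[of ?C "{CE. edge_cutset V E x CE}" "?s 0"] by simp
  show "?\<theta> p = 0" if "(INF CE\<in>{CE. edge_cutset V E x CE}. ?s p CE) = 0" for p
  proof -
    have "emeasure (perc E p) {\<omega>\<in>space (perc E p). connects_to_infinity E x \<omega>} \<le>
        (INF CE\<in>{CE. edge_cutset V E x CE}. ?s p CE)"
      by (intro INF_greatest emeasure_connects_le_edge_cutset) simp
    then show ?thesis using that by (simp add: measure_def)
  qed
  show "?\<theta> q \<noteq> 0" if "0 \<le> p" "p < q" "q \<le> 1" "(INF CE\<in>{CE. edge_cutset V E x CE}. ?s p CE) \<noteq> 0" for p q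
  proof (rule percolates_above[OF that])
    fix S assume S: "finite S" "x \<in> S" "S \<subseteq> V"
    \<comment> \<open>Boundaries of finite sets are among the cutsets, so the nonzero infimum is a
      lower bound uniform in \<open>S\<close>.\<close>
    have "(INF CE\<in>{CE. edge_cutset V E x CE}. ?s p CE) \<le> ?s p (edge_boundary E S)"
      using cut[OF S(1,2)] by (intro INF_lower) simp
    also have "\<dots> \<le> ennreal (\<Sum>e\<in>edge_boundary E S. measure (perc E p) (inner_reach p S e))"
      using S that by (intro sum_A_edge_le) auto
    finally show "(INF CE\<in>{CE. edge_cutset V E x CE}. ?s p CE) \<le>
      ennreal (\<Sum>e\<in>edge_boundary E S. measure (perc E p) (inner_reach p S e))" .
  qed
qed

lemma p_cut_V_eq_p_c: "p_cut_V V E x = p_c V E x"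
  unfolding p_cut_V_def p_c_def
proof (rule Sup_threshold_eq)
  let ?s = "\<lambda>p C. infsum (\<lambda>v. emeasure (perc E p) {\<omega>\<in>space (perc E p). A_vertex E x v C \<omega>}) C"
  let ?\<theta> = "\<lambda>p. measure (perc E p) {\<omega>\<in>space (perc E p). connects_to_infinity E x \<omega>}"
  have cut: "vertex_cutset V E x (vertex_boundary E S)" if "finite S" "x \<in> S" "S \<subseteq> V" for S
    using that by (rule vertex_cutset_vertex_boundary)
  \<comment> \<open>Radius 1 keeps \<open>x\<close> off the cutset: all edges at \<open>x\<close>
    lie inside this ball. A cutset containing \<open>x\<close> would fail as a witness, since the
    one-vertex path makes \<open>A_vertex E x x C\<close> certain.\<close>
  let ?S = "gball E x 1"
  let ?C = "vertex_boundary E ?S"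
  have "e \<subseteq> ?S" if "e \<in> E" "x \<in> e" for e
  proof -
    have "y \<in> ?S" if "y \<in> e" "y \<noteq> x" for y
    proof -
      have "e = {x, y}" using edge_cases[OF \<open>e \<in> E\<close>] \<open>x \<in> e\<close> that by auto
      then have "(x, y) \<in> adj E ^^ 1" using \<open>e \<in> E\<close> by (simp add: adj_def)
      then show ?thesis unfolding gball_def by blast
    qed
    moreover have "x \<in> ?S" using gball_mono[of 0 1 E x] by auto
    ultimately show ?thesis by blast
  qed
  then have x: "x \<notin> ?C" by (auto simp: vertex_boundary_def edge_boundary_def)
  have "emeasure (perc E 0) {\<omega>\<in>space (perc E 0). A_vertex E x v ?C \<omega>} = 0" if "v \<in> ?C" for v
  proof (rule emeasure_eq_0_AE)
    have closed: "\<not> A_vertex E x v ?C \<omega>" if "\<forall>e\<in>E. \<not> \<omega> e" for \<omega>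
    proof -
      have "adj {g\<in>E. \<omega> g \<and> g \<inter> (?C - {v}) = {}} = {}" using that by (auto simp: adj_def)
      then show ?thesis using x \<open>v \<in> ?C\<close> by (auto simp: A_vertex_iff)
    qed
    show "AE \<omega> in perc E 0. \<not> A_vertex E x v ?C \<omega>"
      using AE_perc_zero_closed[OF countable_E] by eventually_elim (rule closed)
  qed
  then have "?s 0 ?C = 0" by (intro infsum_0) auto
  moreover have "vertex_cutset V E x ?C"
    using finite_gball gball_subset gball_mono[of 0 1 E x] by (intro cut) auto
  ultimately show "(INF C\<in>{C. vertex_cutset V E x C}. ?s 0 C) = 0"
    using INF_lower[of ?C "{C. vertex_cutset V E x C}" "?s 0"] by simp
  show "?\<theta> p = 0" if "(INF C\<in>{C. vertex_cutset V E x C}. ?s p C) = 0" for p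
  proof -
    have "emeasure (perc E p) {\<omega>\<in>space (perc E p). connects_to_infinity E x \<omega>} \<le>
        (INF C\<in>{C. vertex_cutset V E x C}. ?s p C)"
      by (intro INF_greatest emeasure_connects_le_vertex_cutset) simp
    then show ?thesis using that by (simp add: measure_def)
  qed
  show "?\<theta> q \<noteq> 0" if "0 \<le> p" "p < q" "q \<le> 1" "(INF C\<in>{C. vertex_cutset V E x C}. ?s p C) \<noteq> 0" for p q
  proof (rule percolates_above[OF that])
    fix S assume S: "finite S" "x \<in> S" "S \<subseteq> V"
    have "(INF C\<in>{C. vertex_cutset V E x C}. ?s p C) \<le> ?s p (vertex_boundary E S)"
      using cut[OF S] by (intro INF_lower) simp
    also have "\<dots> \<le> ennreal (\<Sum>e\<in>edge_boundary E S. measure (perc E p) (inner_reach p S e))"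
      using S that by (intro sum_A_vertex_le) auto
    finally show "(INF C\<in>{C. vertex_cutset V E x C}. ?s p C) \<le>
      ennreal (\<Sum>e\<in>edge_boundary E S. measure (perc E p) (inner_reach p S e))" .
  qed
qed

end

theorem theorem1p6:
  fixes V :: "'a set" and E :: "'a set set" and x :: 'a
  assumes "simple_graph V E"
    and "locally_finite V E"
    and "graph_connected V E"
    and "infinite V"
    and "x \<in> V"
  shows "p_cut_E V E x = p_cut_V V E x \<and> p_cut_V V E x = p_c V E x"
proof -
  interpret percolation_graph V E x
    using assms by unfold_locales
  show ?thesis
    by (simp add: p_cut_E_eq_p_c p_cut_V_eq_p_c)
qed

end
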